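(* Let $f$ be a probability density on $\mathbb{R}^d$ satisfying the standing assumptions listed in the context. Suppose that $x$ is in the basin of attraction of a mode $x_*$ of $f$, i.e., $\gamma_x(t)\to x_*$ as $t\to\infty$. Then there is $\eta_0>0$ (depending on $f$ and $x$) such that, for every $0<\eta\le\eta_0$, Algorithm 1 with step size $\eta$ and starting point $x$ returns the mode $x_*$. Furthermore, as $\eta\to 0$, the polygonal line connecting the sequence $(q_k)$ computed by the algorithm converges, in Hausdorff distance, to the gradient ascent line $\{\gamma_x(t): t\ge 0\}$ originating at $x$.
   Context: Standing assumptions on $f$: $f$ is a probability density with respect to Lebesgue measure on $\mathbb{R}^d$ such that (i) $f(x)\to 0$ as $\|x\|\to\infty$; (ii) $f$ is twice continuously differentiable everywhere, with $f$ and its first and second derivatives bounded; (iii) the Hessian of $f$ is non-singular at every critical point of $f$. A mode is a local maximum of $f$. The gradient flow: for $x\in\mathbb{R}^d$, $\gamma_x:[0,\infty)\to\mathbb{R}^d$ is the solution of $\gamma_x(0)=x$, $\dot\gamma_x(t)=\nabla f(\gamma_x(t))$. The basin of attraction of a point $x_0$ is $\{x:\lim_{t\to\infty}\gamma_x(t)=x_0\}$. For $t>0$, $\mathcal{L}_t:=\{y: f(y)=t\}$ and $\mathcal{U}_t:=\{y: f(y)\ge t\}$. For a point $y$ and $t\le f(y)$, $\mathcal{C}_t(y)$ denotes the connected component of $\mathcal{U}_t$ containing $y$. A metric projection of a point $y$ onto a closed nonempty set $A$ is any point of $A$ at minimal Euclidean distance from $y$. Algorithm 1 (step size $\eta>0$,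 starting point $x$ in the support of $f$): set $t_0=f(x)$ and $t_k=t_0+k\eta$ for $k\ge1$. Set $q_0=x$. For $k=1,2,\dots$: let $q_k$ be a metric projection of $q_{k-1}$ onto $\mathcal{L}_{t_k}$ (any choice if it is not unique); if $\mathcal{L}_{t_k}=\emptyset$ or if $q_k\notin\mathcal{C}_{t_{k-1}}(q_{k-1})$, stop and return $\operatorname{arg\,max}_{\mathcal{C}_{t_{k-1}}(q_{k-1})} f$. "Returns $x_*$" means that this set of maximizers is $\{x_*\}$. If the algorithm stops at step $k=m+1$, the sequence computed is $q_0,\dots,q_m$ (the point rejected at the stopping step is not part of it), and the polygonal line is $\bigcup_{k=1}^{m}[q_{k-1},q_k]$ (it is $\{q_0\}$ if $m=0$). The Hausdorff distance between $A,B\subset\mathbb{R}^d$ is $\max\{\sup_{a\in A}\inf_{b\in B}\|a-b\|,\ \sup_{b\in B}\inf_{a\in A}\|a-b\|\}$. *)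

theory Defs
  imports "HOL-Analysis.Analysis"
begin

definition gradient :: "('a::euclidean_space \<Rightarrow> real) \<Rightarrow> 'a \<Rightarrow> 'a" where
  "gradient f x = (THE D. GDERIV f x :> D)"

definition hessian :: "('a::euclidean_space \<Rightarrow> real) \<Rightarrow> 'a \<Rightarrow> 'a \<Rightarrow> 'a" where
  "hessian f x = frechet_derivative (gradient f) (at x)"

definition probability_density :: "('a::euclidean_space \<Rightarrow> real) \<Rightarrow> bool" where
  "probability_density f \<longleftrightarrow>
     (\<forall>x. 0 \<le> f x) \<and> integrable lborel f \<and> integral\<^sup>L lborel f = 1"

text \<open>Continuity and boundedness of the second derivative are stated columnwise,
  i.e. for \<open>x \<mapsto> hessian f x v\<close> with \<open>v\<close> fixed; by linearity in \<open>v\<close>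
  this is continuity, respectively boundedness, of all second partial derivatives.\<close>

definition C2_bounded :: "('a::euclidean_space \<Rightarrow> real) \<Rightarrow> bool" where
  "C2_bounded f \<longleftrightarrow>
     (\<forall>x. f differentiable (at x)) \<and>
     (\<forall>x. gradient f differentiable (at x)) \<and>
     (\<forall>v. continuous_on UNIV (\<lambda>x. hessian f x v)) \<and>
     bounded (range f) \<and>
     bounded (range (gradient f)) \<and>
     (\<forall>v. bounded (range (\<lambda>x. hessian f x v)))"

definition nondegenerate_critical_points :: "('a::euclidean_space \<Rightarrow> real) \<Rightarrow> bool" where
  "nondegenerate_critical_points f \<longleftrightarrow>
     (\<forall>x. gradient f x = 0 \<longrightarrow> bij (hessian f x))"

definition is_mode :: "('a::euclidean_space \<Rightarrow> real) \<Rightarrow> 'a \<Rightarrow> bool" where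
  "is_mode f z \<longleftrightarrow> (\<forall>\<^sub>F y in nhds z. f y \<le> f z)"

text \<open>For \<open>C2_bounded f\<close> the gradient is globally Lipschitz, so such a \<open>\<gamma>\<close> exists
  and is unique on \<open>{0..}\<close>; its values at negative times are irrelevant.\<close>

definition gradient_flow_line :: "('a::euclidean_space \<Rightarrow> real) \<Rightarrow> 'a \<Rightarrow> (real \<Rightarrow> 'a) \<Rightarrow> bool" where
  "gradient_flow_line f x \<gamma> \<longleftrightarrow>
     \<gamma> 0 = x \<and>
     (\<forall>t\<ge>0. (\<gamma> has_vector_derivative gradient f (\<gamma> t)) (at t within {0..}))"

definition basin_of_attraction :: "('a::euclidean_space \<Rightarrow> real) \<Rightarrow> 'a \<Rightarrow> 'a set" where
  "basin_of_attraction f z = {x. \<exists>\<gamma>. gradient_flow_line f x \<gamma> \<and> (\<gamma> \<longlongrightarrow> z) at_top}"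

definition level_set :: "('a::euclidean_space \<Rightarrow> real) \<Rightarrow> real \<Rightarrow> 'a set" where
  "level_set f t = {y. f y = t}"

definition upper_level_set :: "('a::euclidean_space \<Rightarrow> real) \<Rightarrow> real \<Rightarrow> 'a set" where
  "upper_level_set f t = {y. t \<le> f y}"

definition level_component :: "('a::euclidean_space \<Rightarrow> real) \<Rightarrow> real \<Rightarrow> 'a \<Rightarrow> 'a set" where
  "level_component f t y = connected_component_set (upper_level_set f t) y"

definition metric_projections :: "'a::euclidean_space \<Rightarrow> 'a set \<Rightarrow> 'a set" where
  "metric_projections y A = {p \<in> A. \<forall>a\<in>A. dist y p \<le> dist y a}"

definition maximizers_on :: "('a::euclidean_space \<Rightarrow> real) \<Rightarrow> 'a set \<Rightarrow> 'a set" where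
  "maximizers_on f C = {z \<in> C. \<forall>w\<in>C. f w \<le> f z}"

text \<open>The algorithm with step size \<open>\<eta>\<close> and starting point \<open>x\<close> runs through the levels
  \<open>t k = f x + k * \<eta>\<close>. It is nondeterministic, since metric projections need not be unique;
  an execution is described by the sequence \<open>q\<close> of computed points.\<close>

definition alg_level :: "('a::euclidean_space \<Rightarrow> real) \<Rightarrow> real \<Rightarrow> 'a \<Rightarrow> nat \<Rightarrow> real" where
  "alg_level f \<eta> x k = f x + real k * \<eta>"

text \<open>Steps \<open>1, \<dots>, m\<close> have been carried out without stopping, with points
  \<open>q 0, \<dots>, q m\<close> (the values of \<open>q\<close> beyond \<open>m\<close> are irrelevant).\<close>

definition alg_run ::
  "('a::euclidean_space \<Rightarrow> real) \<Rightarrow> real \<Rightarrow> 'a \<Rightarrow> (nat \<Rightarrow> 'a) \<Rightarrow> nat \<Rightarrow> bool" where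
  "alg_run f \<eta> x q m \<longleftrightarrow>
     q 0 = x \<and>
     (\<forall>k\<in>{1..m}.
        q k \<in> metric_projections (q (k - 1)) (level_set f (alg_level f \<eta> x k)) \<and>
        q k \<in> level_component f (alg_level f \<eta> x (k - 1)) (q (k - 1)))"

text \<open>The execution stops at step \<open>m + 1\<close>; the projection \<open>p\<close> chosen at that step is
  rejected and does not belong to the computed sequence.\<close>

definition alg_stops ::
  "('a::euclidean_space \<Rightarrow> real) \<Rightarrow> real \<Rightarrow> 'a \<Rightarrow> (nat \<Rightarrow> 'a) \<Rightarrow> nat \<Rightarrow> bool" where
  "alg_stops f \<eta> x q m \<longleftrightarrow>
     alg_run f \<eta> x q m \<and>
     (level_set f (alg_level f \<eta> x (m + 1)) = {} \<or>
      (\<exists>p \<in> metric_projections (q m) (level_set f (alg_level f \<eta> x (m + 1))).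
          p \<notin> level_component f (alg_level f \<eta> x m) (q m)))"

definition alg_output ::
  "('a::euclidean_space \<Rightarrow> real) \<Rightarrow> real \<Rightarrow> 'a \<Rightarrow> (nat \<Rightarrow> 'a) \<Rightarrow> nat \<Rightarrow> 'a set" where
  "alg_output f \<eta> x q m = maximizers_on f (level_component f (alg_level f \<eta> x m) (q m))"

text \<open>Total correctness over all choices of projections: some execution stops, none
  continues forever, and each one that stops has \<open>z\<close> as its only maximizer.\<close>

definition alg_returns ::
  "('a::euclidean_space \<Rightarrow> real) \<Rightarrow> real \<Rightarrow> 'a \<Rightarrow> 'a \<Rightarrow> bool" where
  "alg_returns f \<eta> x z \<longleftrightarrow>
     (\<exists>q m. alg_stops f \<eta> x q m) \<and>
     \<not> (\<exists>q. \<forall>m. alg_run f \<eta> x q m) \<and>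
     (\<forall>q m. alg_stops f \<eta> x q m \<longrightarrow> alg_output f \<eta> x q m = {z})"

definition polygonal_line :: "(nat \<Rightarrow> 'a::euclidean_space) \<Rightarrow> nat \<Rightarrow> 'a set" where
  "polygonal_line q m =
     (if m = 0 then {q 0} else (\<Union>k\<in>{1..m}. closed_segment (q (k - 1)) (q k)))"

text \<open>Valued in \<open>[0, \<infinity>]\<close>, so that suprema over unbounded sets are meaningful.\<close>

definition hausdorff_distance :: "'a::metric_space set \<Rightarrow> 'a set \<Rightarrow> ennreal" where
  "hausdorff_distance A B =
     max (SUP a\<in>A. INF b\<in>B. ennreal (dist a b)) (SUP b\<in>B. INF a\<in>A. ennreal (dist a b))"

end

theory Submission
  imports Defs
begin

text \<open>As long as the gradient is bounded away from zero, a projection step from \<open>q\<close> to \<open>p\<close> has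
  length \<open>O(\<eta>)\<close>, stays in the component, and satisfies \<open>p - q = \<tau> \<nabla>f(p)\<close>, since \<open>p\<close> maximizes
  \<open>f\<close> on the ball around \<open>q\<close> through \<open>p\<close>. So the algorithm is the implicit Euler scheme
  with variable time steps for the gradient flow, and its points stay within \<open>O(\<eta>)\<close> of the flow
  line over any bounded time interval; on such an interval it cannot stop, and it must leave it
  because \<open>f\<close> is bounded. Once a point is close to the mode, which is an isolated critical
  point and hence a strict maximum, its level component is confined to a small ball around the
  mode. The later points remain in that ball, and the mode is the only possible maximizer.\<close>

section \<open>Gradients and ascent directions\<close>

lemma GDERIV_unique:
  fixes f :: "'a::euclidean_space \<Rightarrow> real"
  assumes "GDERIV f x :> D" "GDERIV f x :> E"
  shows "D = E"
proof -
  have "(\<lambda>h. h \<bullet> D) = (\<lambda>h. h \<bullet> E)"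
    using assms unfolding gderiv_def by (rule has_derivative_unique)
  then show ?thesis
    by (metis vector_eq_ldot)
qed

text \<open>By Riesz representation the derivative is the inner product with its adjoint applied to
  1; uniqueness then makes the definite description in \<open>gradient\<close> denote that
  vector.\<close>

lemma GDERIV_gradient:
  fixes f :: "'a::euclidean_space \<Rightarrow> real"
  assumes "f differentiable (at x)"
  shows "GDERIV f x :> gradient f x"
proof -
  obtain f' where f': "(f has_derivative f') (at x)"
    using assms unfolding differentiable_def by blast
  have "f' = (\<lambda>h. h \<bullet> adjoint f' 1)"
    using adjoint_works[OF has_derivative_linear[OF f'], where y = 1] by auto
  with f' have "GDERIV f x :> adjoint f' 1"
    unfolding gderiv_def by simp
  then show ?thesis
    unfolding gradient_def using GDERIV_unique by (metis theI)
qed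

lemma GDERIV_line:
  fixes f :: "'a::euclidean_space \<Rightarrow> real"
  assumes "GDERIV f (z + s *\<^sub>R v) :> D"
  shows "((\<lambda>s. f (z + s *\<^sub>R v)) has_real_derivative v \<bullet> D) (at s)"
proof -
  have "(f has_derivative (\<lambda>h. h \<bullet> D)) (at (z + s *\<^sub>R v) within range (\<lambda>s. z + s *\<^sub>R v))"
    using assms unfolding gderiv_def by (rule has_derivative_at_withinI)
  moreover have "((\<lambda>s. z + s *\<^sub>R v) has_derivative (\<lambda>h. h *\<^sub>R v)) (at s)"
    by (auto intro!: derivative_eq_intros)
  ultimately have "((\<lambda>s. f (z + s *\<^sub>R v)) has_derivative (\<lambda>h. (h *\<^sub>R v) \<bullet> D)) (at s)"
    using has_derivative_in_compose by blast
  then show ?thesis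
    by (rule has_derivative_imp_has_field_derivative) simp
qed

text \<open>Serves to refute maximality: at a local maximum with nonzero gradient, at a projection
  whose step is not aligned with the gradient, and at a maximizer over a component.\<close>

lemma GDERIV_ascent_direction:
  fixes f :: "'a::euclidean_space \<Rightarrow> real"
  assumes "GDERIV f z :> D" "v \<bullet> D > 0"
  obtains \<delta> where "\<delta> > 0" "\<And>s. 0 < s \<Longrightarrow> s < \<delta> \<Longrightarrow> f z < f (z + s *\<^sub>R v)"
proof -
  have "((\<lambda>s. f (z + s *\<^sub>R v)) has_real_derivative v \<bullet> D) (at 0)"
    using assms(1) by (intro GDERIV_line) simp
  from DERIV_pos_inc_right[OF this assms(2)] show ?thesis
    using that by auto
qed

lemma GDERIV_local_max_eq_0:
  fixes f :: "'a::euclidean_space \<Rightarrow> real"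
  assumes "GDERIV f z :> D" "open S" "z \<in> S" "\<And>y. y \<in> S \<Longrightarrow> f y \<le> f z"
  shows "D = 0"
proof (rule ccontr)
  assume "D \<noteq> 0"
  then obtain \<delta> where \<delta>: "\<delta> > 0" "\<And>s. 0 < s \<Longrightarrow> s < \<delta> \<Longrightarrow> f z < f (z + s *\<^sub>R D)"
    using GDERIV_ascent_direction[OF assms(1), of D] by auto
  obtain e where e: "e > 0" "ball z e \<subseteq> S"
    using assms open_contains_ball by blast
  define s where "s = min (\<delta> / 2) (e / (2 * norm D))"
  have s: "0 < s" "s < \<delta>" "s * norm D < e"
    using \<delta>(1) e(1) \<open>D \<noteq> 0\<close> by (auto simp: s_def min_def field_simps split: if_splits)
  then have "z + s *\<^sub>R D \<in> S"
    using e(2) by (auto simp: dist_norm subset_iff)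
  then show False
    using \<delta>(2)[OF s(1,2)] assms(4) by force
qed

section \<open>Lipschitz gradients and isolated critical points\<close>

text \<open>The Hessian is bounded column by column, so the sum of the bounds over the basis
  dominates its operator norm uniformly, and the mean value inequality applies on the whole
  space.\<close>

lemma C2_bounded_gradient_lipschitz:
  fixes f :: "'a::euclidean_space \<Rightarrow> real"
  assumes "C2_bounded f"
  obtains L where "L > 0" "\<And>x y. norm (gradient f x - gradient f y) \<le> L * norm (x - y)"
proof -
  have der: "(gradient f has_derivative hessian f x) (at x)" for x
    using assms unfolding C2_bounded_def hessian_def by (simp add: frechet_derivative_works)
  have "\<exists>B. \<forall>x. norm (hessian f x b) \<le> B" for b
    using assms unfolding C2_bounded_def bounded_iff by blast
  then obtain B where B: "\<And>b x. norm (hessian f x b) \<le> B b"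
    by metis
  \<comment> \<open>The summand 1 keeps \<open>L\<close> positive even if all column bounds
    vanish.\<close>
  define L where "L = (\<Sum>b\<in>Basis. B b) + 1"
  have "B b \<ge> 0" for b
    using order_trans[OF norm_ge_zero B] .
  then have L: "L > 0"
    unfolding L_def by (simp add: add_nonneg_pos sum_nonneg)
  have "onorm (hessian f x) \<le> L" for x
    using onorm_componentwise[OF has_derivative_bounded_linear[OF der[of x]]]
      sum_mono[of Basis "\<lambda>b. norm (hessian f x b)" B] B
    unfolding L_def by force
  then have "norm (gradient f x - gradient f y) \<le> L * norm (x - y)" for x y
    using differentiable_bound[of UNIV "gradient f" "hessian f" L x y] der by simp
  with L that show ?thesis by blast
qed

text \<open>An injective linear map on a finite-dimensional space is bounded below by some
  \<open>B > 0\<close>. Near \<open>z\<close> the linearization error is at most half of that bound,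
  which leaves no room for a second zero.\<close>

lemma nonsingular_derivative_isolated_zero:
  fixes g :: "'a::euclidean_space \<Rightarrow> 'a"
  assumes der: "(g has_derivative H) (at z)" and "inj H" "g z = 0"
  obtains \<rho> where "\<rho> > 0" "\<And>y. y \<in> ball z \<rho> \<Longrightarrow> g y = 0 \<Longrightarrow> y = z"
proof -
  obtain B where B: "B > 0" "\<And>x. B * norm x \<le> norm (H x)"
    using linear_inj_bounded_below_pos[OF has_derivative_linear[OF der] \<open>inj H\<close>] by blast
  obtain d where d: "d > 0"
    "\<And>y. norm (y - z) < d \<Longrightarrow> norm (g y - g z - H (y - z)) \<le> B / 2 * norm (y - z)"
    using der B(1) unfolding has_derivative_at_alt by (meson half_gt_zero)
  show ?thesis
  proof (rule that[OF d(1)])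
    fix y assume y: "y \<in> ball z d" "g y = 0"
    then have "norm (H (y - z)) \<le> B / 2 * norm (y - z)"
      using d(2)[of y] \<open>g z = 0\<close> by (simp add: dist_norm norm_minus_commute)
    with B(2)[of "y - z"] have "B * norm (y - z) \<le> B / 2 * norm (y - z)"
      by linarith
    then show "y = z"
      using B(1) by auto
  qed
qed

section \<open>A single projection step\<close>

text \<open>Every local estimate below compares \<open>g\<close> at two nearby points; bounds
  \<open>M\<close> on \<open>f\<close> and \<open>G\<close> on \<open>g\<close> enter as assumptions
  of individual lemmas.\<close>

locale lipschitz_gradient =
  fixes f :: "'a::euclidean_space \<Rightarrow> real" and g :: "'a \<Rightarrow> 'a" and L :: real
  assumes gderiv: "GDERIV f x :> g x"
    and L_pos: "L > 0"
    and lipschitz: "norm (g x - g y) \<le> L * norm (x - y)"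
begin

lemma continuous_f: "continuous_on S f"
  using gderiv unfolding gderiv_def
  by (meson continuous_at_imp_continuous_on has_derivative_continuous)

lemma norm_gradient_ge: "norm (g y) \<ge> norm (g x) - L * norm (x - y)"
  using lipschitz[of x y] norm_triangle_ineq2[of "g x" "g y"] by linarith

lemma closed_upper_level_set: "closed (upper_level_set f t)"
  unfolding upper_level_set_def
  using closed_Collect_le[OF continuous_on_const continuous_f[of UNIV]] by simp

lemma closed_level_set: "closed (level_set f t)"
  unfolding level_set_def
  using closed_Collect_eq[OF continuous_f[of UNIV] continuous_on_const] by simp

lemma metric_projections_level_set_nonempty:
  assumes "level_set f t \<noteq> {}"
  shows "metric_projections q (level_set f t) \<noteq> {}"
proof -
  obtain p where "p \<in> level_set f t" "\<And>y. y \<in> level_set f t \<Longrightarrow> dist q p \<le> dist q y"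
    using distance_attains_inf[OF closed_level_set assms, of q] by metis
  then show ?thesis
    unfolding metric_projections_def by auto
qed

lemma line_mvt:
  assumes "0 < s"
  obtains \<xi> where "0 < \<xi>" "\<xi> < s" "f (z + s *\<^sub>R v) - f z = s * (v \<bullet> g (z + \<xi> *\<^sub>R v))"
proof -
  have "\<exists>\<xi>. 0 < \<xi> \<and> \<xi> < s \<and>
      f (z + s *\<^sub>R v) - f (z + 0 *\<^sub>R v) = (s - 0) * (v \<bullet> g (z + \<xi> *\<^sub>R v))"
    using assms by (intro MVT2 GDERIV_line[OF gderiv]) auto
  with that show ?thesis
    by auto
qed

text \<open>The derivative along \<open>sgn (g q)\<close> starts at \<open>norm (g q)\<close> and
  loses at most \<open>L * s\<close> over the length \<open>s\<close>, hence keeps at least half of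
  its initial value.\<close>

lemma gradient_direction_increase:
  assumes "0 < s" "L * s \<le> norm (g q) / 2" "g q \<noteq> 0"
  shows "f (q + s *\<^sub>R sgn (g q)) \<ge> f q + s * norm (g q) / 2"
proof -
  define u where "u = sgn (g q)"
  have u: "norm u = 1" "u \<bullet> g q = norm (g q)"
    using \<open>g q \<noteq> 0\<close> by (simp_all add: u_def norm_sgn sgn_div_norm dot_square_norm power2_eq_square)
  obtain \<xi> where \<xi>: "0 < \<xi>" "\<xi> < s" "f (q + s *\<^sub>R u) - f q = s * (u \<bullet> g (q + \<xi> *\<^sub>R u))"
    using line_mvt[OF \<open>0 < s\<close>] .
  have "norm (u \<bullet> (g (q + \<xi> *\<^sub>R u) - g q)) \<le> norm u * (L * norm (\<xi> *\<^sub>R u))"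
    using Cauchy_Schwarz_ineq2[of u "g (q + \<xi> *\<^sub>R u) - g q"] lipschitz[of "q + \<xi> *\<^sub>R u" q] u(1)
    by simp
  then have "\<bar>u \<bullet> (g (q + \<xi> *\<^sub>R u) - g q)\<bar> \<le> L * \<xi>"
    using u(1) \<xi>(1) by simp
  moreover have "L * \<xi> \<le> L * s"
    using \<xi>(2) L_pos by simp
  ultimately have "u \<bullet> g (q + \<xi> *\<^sub>R u) \<ge> norm (g q) / 2"
    using u(2) assms(2) by (simp add: inner_diff_right)
  then have "s * (u \<bullet> g (q + \<xi> *\<^sub>R u)) \<ge> s * (norm (g q) / 2)"
    using \<open>0 < s\<close> by simp
  then show ?thesis
    using \<xi>(3) unfolding u_def by linarith
qed

text \<open>Walking the length \<open>2 * \<eta> / norm (g q)\<close> along the gradient gains at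
  least \<open>\<eta>\<close>, so by the intermediate value theorem the level is attained on the
  way. This shows that the next level set is nonempty and bounds the distance to it.\<close>

lemma level_set_near:
  assumes "c > 0" "norm (g q) \<ge> c" "\<eta> > 0" "4 * L * \<eta> \<le> c\<^sup>2"
  obtains y where "y \<in> level_set f (f q + \<eta>)" "dist q y \<le> 2 * \<eta> / c"
proof -
  define n where "n = norm (g q)"
  have n: "n \<ge> c" "n > 0" "g q \<noteq> 0"
    using assms by (auto simp: n_def)
  define s where "s = 2 * \<eta> / n"
  define y where "y = q + s *\<^sub>R sgn (g q)"
  \<comment> \<open>The requirement \<open>L * s \<le> n / 2\<close> amounts to
    \<open>4 * L * \<eta> \<le> n\<^sup>2\<close>; hence the square in the bound on
    \<open>\<eta>\<close>.\<close>
  have "c\<^sup>2 \<le> n\<^sup>2"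
    using n assms by (simp add: power_mono)
  then have s: "0 < s" "L * s \<le> n / 2"
    using n assms by (auto simp: s_def field_simps power2_eq_square)
  have "f y \<ge> f q + s * n / 2"
    using gradient_direction_increase[OF s(1) _ n(3)] s(2) by (simp add: y_def n_def)
  also have "s * n / 2 = \<eta>"
    using n by (simp add: s_def)
  finally have fy: "f y \<ge> f q + \<eta>" .
  have "connected (f ` closed_segment q y)"
    by (intro connected_continuous_image continuous_f connected_segment)
  moreover have "f q \<in> f ` closed_segment q y" "f y \<in> f ` closed_segment q y"
    by auto
  ultimately have "f q + \<eta> \<in> f ` closed_segment q y"
    unfolding connected_iff_interval using fy \<open>\<eta> > 0\<close> by (metis add.right_neutral add_left_mono less_imp_le)
  then obtain w where w: "w \<in> closed_segment q y" "f w = f q + \<eta>"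
    by auto
  have "dist q w \<le> dist q y"
    using dist_in_closed_segment[OF w(1)] by (simp add: dist_commute)
  also have "\<dots> = s"
    using n s by (simp add: y_def norm_sgn dist_norm)
  also have "\<dots> \<le> 2 * \<eta> / c"
    unfolding s_def using n assms by (intro divide_left_mono) auto
  finally show ?thesis
    using that[of w] w(2) by (simp add: level_set_def)
qed

text \<open>The projection of \<open>q\<close> onto a higher level set maximizes \<open>f\<close> on the ball around \<open>q\<close>
  that touches this level set, so the gradient there is normal to the sphere.\<close>

lemma metric_projection_maximizes:
  assumes p: "p \<in> metric_projections q (level_set f t)" and "f q < t" and y: "dist q y < dist q p"
  shows "f y < t"
proof (rule ccontr)
  assume "\<not> f y < t"
  have "connected (f ` closed_segment q y)"
    by (intro connected_continuous_image continuous_f connected_segment)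
  moreover have "f q \<in> f ` closed_segment q y" "f y \<in> f ` closed_segment q y"
    by auto
  ultimately have "t \<in> f ` closed_segment q y"
    unfolding connected_iff_interval using \<open>\<not> f y < t\<close> \<open>f q < t\<close> by (meson less_imp_le not_less)
  then obtain w where w: "w \<in> closed_segment q y" "f w = t"
    by auto
  then have "dist q p \<le> dist q w"
    using p by (auto simp: metric_projections_def level_set_def)
  also have "\<dots> \<le> dist q y"
    using dist_in_closed_segment[OF w(1)] by (simp add: dist_commute)
  finally show False
    using y by simp
qed

lemma metric_projection_normal:
  assumes p: "p \<in> metric_projections q (level_set f t)" and "f q < t" and "g p \<noteq> 0"
  shows "p - q = norm (p - q) *\<^sub>R sgn (g p)"
proof (rule ccontr)
  assume neq: "p - q \<noteq> norm (p - q) *\<^sub>R sgn (g p)"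
  define d where "d = norm (p - q)"
  have fp: "f p = t"
    using p by (simp add: metric_projections_def level_set_def)
  then have d: "d > 0"
    using \<open>f q < t\<close> by (auto simp: d_def)
  define a where "a = sgn (p - q)"
  define b where "b = sgn (g p)"
  \<comment> \<open>For distinct unit vectors \<open>a\<close> and \<open>b\<close>, the difference
    \<open>v\<close> has positive inner product with \<open>b\<close> and negative inner product
    with \<open>a\<close>: it ascends at \<open>p\<close> and points into the ball around
    \<open>q\<close>.\<close>
  define v where "v = b - a"
  have pq: "p - q = d *\<^sub>R a"
    using d by (simp add: a_def d_def sgn_div_norm)
  have gp: "g p = norm (g p) *\<^sub>R b"
    using \<open>g p \<noteq> 0\<close> by (simp add: b_def sgn_div_norm)
  have ab: "a \<bullet> a = 1" "b \<bullet> b = 1"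
    using d \<open>g p \<noteq> 0\<close> by (auto simp: a_def b_def d_def norm_sgn dot_square_norm)
  have "v \<noteq> 0"
    using neq pq unfolding v_def b_def d_def by (metis eq_iff_diff_eq_0)
  then have v_pos: "v \<bullet> v > 0"
    by simp
  have va: "2 * (v \<bullet> a) = - (v \<bullet> v)" and vb: "2 * (v \<bullet> b) = v \<bullet> v"
    using ab by (simp_all add: v_def inner_diff_left inner_diff_right inner_commute)
  have "v \<bullet> g p = norm (g p) * (v \<bullet> b)"
    by (subst gp) simp
  then have "v \<bullet> g p > 0"
    using vb v_pos \<open>g p \<noteq> 0\<close> by (metis mult_pos_pos zero_less_mult_pos zero_less_norm_iff zero_less_numeral)
  then obtain \<delta> where \<delta>: "\<delta> > 0" "\<And>s. 0 < s \<Longrightarrow> s < \<delta> \<Longrightarrow> f p < f (p + s *\<^sub>R v)"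
    using GDERIV_ascent_direction[OF gderiv] by blast
  define s where "s = min (\<delta> / 2) (d / 2)"
  have s: "0 < s" "s < \<delta>" "s < d"
    using \<delta>(1) d by (auto simp: s_def)
  have eq: "p + s *\<^sub>R v - q = d *\<^sub>R a + s *\<^sub>R v"
    using pq by (simp add: algebra_simps)
  \<comment> \<open>For \<open>0 < s < d\<close> the perturbed point lies strictly inside the ball,
    where \<open>f\<close> stays below \<open>t\<close>, although \<open>f\<close> has increased
    from its value \<open>t\<close> at \<open>p\<close>.\<close>
  have "(norm (p + s *\<^sub>R v - q))\<^sup>2 = d\<^sup>2 + s * d * (2 * (v \<bullet> a)) + s\<^sup>2 * (v \<bullet> v)"
    unfolding eq power2_norm_eq_inner inner_add_left inner_add_right inner_scaleR_left inner_scaleR_right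
    using ab(1) by (simp add: inner_commute power2_eq_square algebra_simps)
  also have "\<dots> = d\<^sup>2 - s * (v \<bullet> v) * (d - s)"
    unfolding va by (simp add: algebra_simps power2_eq_square)
  also have "\<dots> < d\<^sup>2"
    using s v_pos by simp
  finally have "norm (p + s *\<^sub>R v - q) < d"
    using d by (simp add: power_less_imp_less_base)
  then have "f (p + s *\<^sub>R v) < t"
    using metric_projection_maximizes[OF p \<open>f q < t\<close>, of "p + s *\<^sub>R v"]
    by (simp add: dist_norm d_def norm_minus_commute)
  then show False
    using \<delta>(2)[OF s(1,2)] fp by simp
qed

text \<open>The nearby level set point bounds the length of the step. A step that short changes the
  gradient by at most \<open>c / 2\<close>, so the gradient at \<open>p\<close> is nonzero and
  normality gives the implicit Euler equation. The last claim says that the algorithm accepts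
  \<open>p\<close>.\<close>

lemma metric_projection_step:
  assumes c: "c > 0" "norm (g q) \<ge> c" and \<eta>: "\<eta> > 0" "4 * L * \<eta> \<le> c\<^sup>2"
    and p: "p \<in> metric_projections q (level_set f (f q + \<eta>))"
  shows "norm (g p) \<ge> c / 2" "norm (p - q) \<le> 2 * \<eta> / c"
    "p - q = (norm (p - q) / norm (g p)) *\<^sub>R g p" "p \<in> level_component f (f q) q"
proof -
  define d where "d = norm (p - q)"
  obtain y where y: "y \<in> level_set f (f q + \<eta>)" "dist q y \<le> 2 * \<eta> / c"
    using level_set_near[OF c \<eta>] .
  have "dist q p \<le> dist q y"
    using p y(1) unfolding metric_projections_def by auto
  then show d_le: "norm (p - q) \<le> 2 * \<eta> / c"
    using y(2) by (simp add: dist_norm norm_minus_commute)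
  have "L * d \<le> L * (2 * \<eta> / c)"
    using d_le L_pos unfolding d_def by (intro mult_left_mono) auto
  also have "\<dots> \<le> c / 2"
    using c \<eta> by (simp add: field_simps power2_eq_square)
  finally have Ld: "L * d \<le> c / 2" .
  then show gp: "norm (g p) \<ge> c / 2"
    using norm_gradient_ge[of q p] c(2) by (simp add: d_def norm_minus_commute)
  have "g p \<noteq> 0"
    using gp c(1) by auto
  then have pq: "p - q = d *\<^sub>R sgn (g p)"
    using metric_projection_normal[OF p] \<eta>(1) by (simp add: d_def)
  moreover have "d *\<^sub>R sgn (g p) = (d / norm (g p)) *\<^sub>R g p"
    by (simp add: sgn_div_norm divide_inverse)
  ultimately show "p - q = (norm (p - q) / norm (g p)) *\<^sub>R g p"
    unfolding d_def by (rule trans)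
  have fp: "f p = f q + \<eta>"
    using p by (simp add: metric_projections_def level_set_def)
  then have d: "d > 0"
    using \<eta>(1) by (auto simp: d_def)
  define u where "u = sgn (g p)"
  have u: "norm u = 1" "u \<bullet> g p = norm (g p)"
    using \<open>g p \<noteq> 0\<close> by (simp_all add: u_def norm_sgn sgn_div_norm dot_square_norm power2_eq_square)
  have pu: "p = q + d *\<^sub>R u"
    using pq unfolding u_def by (metis add.commute diff_add_cancel)
  \<comment> \<open>At \<open>p\<close> the derivative along \<open>u\<close> is
    \<open>norm (g p)\<close>, at least \<open>c / 2\<close>; on the segment it differs from this by
    at most \<open>c / 2\<close>, hence is nonnegative.\<close>
  have increase: "f (q + s *\<^sub>R u) \<ge> f q" if s: "0 < s" "s \<le> d" for s
  proof -
    obtain \<xi> where \<xi>: "0 < \<xi>" "\<xi> < s" "f (q + s *\<^sub>R u) - f q = s * (u \<bullet> g (q + \<xi> *\<^sub>R u))"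
      using line_mvt[OF s(1)] .
    have "q + \<xi> *\<^sub>R u - p = (\<xi> - d) *\<^sub>R u"
      by (subst pu) (simp add: algebra_simps)
    then have "norm (q + \<xi> *\<^sub>R u - p) \<le> d"
      using u(1) \<xi> s by simp
    then have "L * norm (q + \<xi> *\<^sub>R u - p) \<le> c / 2"
      using Ld L_pos by (meson mult_left_mono order_trans less_imp_le)
    then have "norm (g (q + \<xi> *\<^sub>R u) - g p) \<le> c / 2"
      using lipschitz[of "q + \<xi> *\<^sub>R u" p] by linarith
    then have "\<bar>u \<bullet> (g (q + \<xi> *\<^sub>R u) - g p)\<bar> \<le> c / 2"
      using Cauchy_Schwarz_ineq2[of u "g (q + \<xi> *\<^sub>R u) - g p"] u(1) by simp
    then have "u \<bullet> g (q + \<xi> *\<^sub>R u) \<ge> 0"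
      using u(2) gp unfolding inner_diff_right by linarith
    then show ?thesis
      using \<xi>(3) s(1) by (metis diff_ge_0_iff_ge less_imp_le mult_nonneg_nonneg)
  qed
  have "closed_segment q p \<subseteq> upper_level_set f (f q)"
  proof
    fix w assume "w \<in> closed_segment q p"
    then obtain r where r: "0 \<le> r" "r \<le> 1" "w = q + r *\<^sub>R (p - q)"
      by (auto simp: in_segment algebra_simps)
    have "w = q + (r * d) *\<^sub>R u"
      unfolding r(3) using pq by (simp add: u_def)
    moreover have "r * d \<le> d"
      using r d by simp
    ultimately show "w \<in> upper_level_set f (f q)"
      using increase[of "r * d"] r(1) d
      by (cases "r = 0") (auto simp: upper_level_set_def)
  qed
  then show "p \<in> level_component f (f q) q"
    unfolding level_component_def
    using connected_component_maximal[OF _ connected_segment] by blast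
qed

section \<open>Level components near a mode\<close>

text \<open>A point near \<open>z\<close> with the same value would itself be a local maximum, hence
  critical, hence equal to \<open>z\<close>.\<close>

lemma strict_isolated_max:
  assumes "is_mode f z" and \<rho>: "\<rho> > 0" "\<And>y. y \<in> ball z \<rho> \<Longrightarrow> g y = 0 \<Longrightarrow> y = z"
  obtains r where "r > 0" "\<forall>y\<in>ball z r - {z}. f y < f z \<and> g y \<noteq> 0"
proof -
  obtain e where e: "e > 0" "\<And>y. y \<in> ball z e \<Longrightarrow> f y \<le> f z"
    using assms(1) unfolding is_mode_def eventually_nhds_metric by (auto simp: dist_commute)
  have "f y < f z \<and> g y \<noteq> 0" if y: "y \<in> ball z (min e \<rho>)" "y \<noteq> z" for y
  proof -
    have gy: "g y \<noteq> 0"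
      using y \<rho>(2) by auto
    have "f y \<noteq> f z"
    proof
      assume "f y = f z"
      then have "g y = 0"
        using e(2) y(1) by (intro GDERIV_local_max_eq_0[OF gderiv[of y], of "ball z e"]) auto
      with gy show False ..
    qed
    then show ?thesis
      using e(2)[of y] y(1) gy by auto
  qed
  then show ?thesis
    using e(1) \<rho>(1) by (intro that[of "min e \<rho>"]) auto
qed

text \<open>A connected set that meets the ball and leaves it must cross the sphere, where
  \<open>f\<close> is below the level.\<close>

lemma level_component_subset_ball:
  assumes "\<rho> > 0" "q \<in> ball z \<rho>" "\<And>y. y \<in> sphere z \<rho> \<Longrightarrow> f y < t"
  shows "level_component f t q \<subseteq> ball z \<rho>"
proof (cases "t \<le> f q")
  case True
  let ?C = "level_component f t q"
  have "connected ?C"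
    by (simp add: level_component_def)
  moreover have "q \<in> ?C"
    using True by (simp add: level_component_def upper_level_set_def)
  moreover have "?C \<inter> sphere z \<rho> = {}"
  proof -
    have "?C \<subseteq> upper_level_set f t"
      by (simp add: level_component_def connected_component_subset)
    then show ?thesis
      using assms(3) by (force simp: upper_level_set_def)
  qed
  ultimately show ?thesis
    using connected_Int_frontier[of ?C "ball z \<rho>"] assms(2) frontier_ball[OF assms(1), of z] by blast
next
  case False
  then have "q \<notin> upper_level_set f t"
    by (simp add: upper_level_set_def)
  then have "level_component f t q = {}"
    unfolding level_component_def using connected_component_eq_empty by blast
  then show ?thesis by simp
qed

text \<open>By compactness \<open>f\<close> is at most some \<open>\<mu> < f z\<close> on the
  sphere. Close to \<open>z\<close> the values exceed \<open>\<mu>\<close>, so a component taken at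
  such a value cannot cross the sphere.\<close>

lemma level_component_captured:
  assumes "\<rho> > 0" "\<And>y. y \<in> sphere z \<rho> \<Longrightarrow> f y < f z"
  obtains \<sigma> where "\<sigma> > 0" "\<And>q. q \<in> ball z \<sigma> \<Longrightarrow> level_component f (f q) q \<subseteq> ball z \<rho>"
proof -
  have "\<exists>\<mu><f z. \<forall>y\<in>sphere z \<rho>. f y \<le> \<mu>"
  proof (cases "sphere z \<rho> = {}")
    case True
    then show ?thesis
      by (metis empty_iff lt_ex)
  next
    case False
    then obtain w where "w \<in> sphere z \<rho>" "\<And>y. y \<in> sphere z \<rho> \<Longrightarrow> f y \<le> f w"
      using continuous_attains_sup[OF compact_sphere False continuous_f] by blast
    then show ?thesis
      using assms(2) by blast
  qed
  then obtain \<mu> where \<mu>: "\<mu> < f z" "\<And>y. y \<in> sphere z \<rho> \<Longrightarrow> f y \<le> \<mu>"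
    by blast
  have "open {q. \<mu> < f q}"
    using continuous_f[of UNIV] by (intro open_Collect_less) auto
  then obtain e where e: "e > 0" "ball z e \<subseteq> {q. \<mu> < f q}"
    using \<mu>(1) open_contains_ball by blast
  show ?thesis
  proof (rule that[of "min e \<rho>"])
    fix q assume "q \<in> ball z (min e \<rho>)"
    then have "q \<in> ball z \<rho>" "\<mu> < f q"
      using e(2) by auto
    then show "level_component f (f q) q \<subseteq> ball z \<rho>"
      using \<mu>(2) assms(1) by (intro level_component_subset_ball) (force)+
  qed (use e assms in auto)
qed

text \<open>A maximizer with nonzero gradient could be improved without leaving the component.\<close>

lemma maximizers_on_level_component:
  assumes "t \<le> f q" and sub: "level_component f t q \<subseteq> ball z \<rho>"
    and crit: "\<And>y. y \<in> ball z \<rho> \<Longrightarrow> g y = 0 \<Longrightarrow> y = z"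
  shows "maximizers_on f (level_component f t q) = {z}"
proof -
  let ?C = "level_component f t q"
  have "q \<in> ?C"
    using assms(1) by (simp add: level_component_def upper_level_set_def)
  moreover have "compact ?C"
    using bounded_subset[OF bounded_ball sub] closed_connected_component[OF closed_upper_level_set]
    by (simp add: level_component_def compact_eq_bounded_closed)
  ultimately obtain w where w: "w \<in> maximizers_on f ?C"
    using continuous_attains_sup[of ?C f] continuous_f unfolding maximizers_on_def by blast
  \<comment> \<open>A maximizer exists because the component is closed and bounded; it remains to
    see that every maximizer is critical.\<close>
  have "y = z" if y: "y \<in> maximizers_on f ?C" for y
  proof -
    have yC: "y \<in> ?C" "\<And>w. w \<in> ?C \<Longrightarrow> f w \<le> f y"
      using y by (auto simp: maximizers_on_def)
    have fy: "t \<le> f y"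
      using yC(1) connected_component_subset[of "upper_level_set f t" q]
      by (auto simp: level_component_def upper_level_set_def)
    have "g y = 0"
    proof (rule ccontr)
      assume "g y \<noteq> 0"
      then obtain \<delta> where \<delta>: "\<delta> > 0" "\<And>s. 0 < s \<Longrightarrow> s < \<delta> \<Longrightarrow> f y < f (y + s *\<^sub>R g y)"
        using GDERIV_ascent_direction[OF gderiv, of "g y" y] by auto
      define w where "w = y + (\<delta> / 2) *\<^sub>R g y"
      have "closed_segment y w \<subseteq> upper_level_set f t"
      proof
        fix v assume "v \<in> closed_segment y w"
        then obtain r where r: "0 \<le> r" "r \<le> 1" "v = (1 - r) *\<^sub>R y + r *\<^sub>R w"
          by (auto simp: in_segment)
        have v: "v = y + (r * (\<delta> / 2)) *\<^sub>R g y"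
          unfolding r(3) w_def by (simp add: algebra_simps)
        have "f y \<le> f v"
        proof (cases "r = 0")
          case False
          have "r * (\<delta> / 2) \<le> 1 * (\<delta> / 2)"
            using r \<delta>(1) by (intro mult_right_mono) auto
          then show ?thesis
            unfolding v using \<delta> r False by (intro less_imp_le \<delta>(2)) auto
        qed (simp add: v)
        then show "v \<in> upper_level_set f t"
          using fy by (simp add: upper_level_set_def)
      qed
      then have "w \<in> connected_component_set (upper_level_set f t) y"
        using connected_component_maximal[OF _ connected_segment, of y y w] by auto
      then have "w \<in> ?C"
        using yC(1) connected_component_eq unfolding level_component_def by metis
      then show False
        using yC(2)[of w] \<delta>(2)[of "\<delta> / 2"] \<delta>(1) by (auto simp: w_def)
    qed
    then show "y = z"
      using crit sub yC(1) by blast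
  qed
  with w show ?thesis by blast
qed

section \<open>Runs of the algorithm: levels, nested components, termination\<close>

lemma alg_run_level:
  assumes "alg_run f \<eta> x q m" "k \<le> m"
  shows "f (q k) = alg_level f \<eta> x k"
  using assms
  by (cases "k = 0")
     (force simp: alg_run_def alg_level_def metric_projections_def level_set_def)+

text \<open>Shifts the index and writes the next level as \<open>f (q k) + \<eta>\<close>, the form
  in which \<open>metric_projection_step\<close> applies.\<close>

lemma alg_run_SucD:
  assumes "alg_run f \<eta> x q m" "k < m"
  shows "q (Suc k) \<in> metric_projections (q k) (level_set f (f (q k) + \<eta>))"
    "q (Suc k) \<in> level_component f (alg_level f \<eta> x k) (q k)"
proof -
  have "Suc k \<in> {1..m}"
    using assms(2) by simp
  then have "q (Suc k) \<in> metric_projections (q k) (level_set f (alg_level f \<eta> x (Suc k)))"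
    "q (Suc k) \<in> level_component f (alg_level f \<eta> x k) (q k)"
    using assms(1) unfolding alg_run_def by (metis diff_Suc_1)+
  moreover have "alg_level f \<eta> x (Suc k) = f (q k) + \<eta>"
    using alg_run_level[of \<eta> x q m k] assms by (simp add: alg_level_def algebra_simps)
  ultimately show "q (Suc k) \<in> metric_projections (q k) (level_set f (f (q k) + \<eta>))"
    "q (Suc k) \<in> level_component f (alg_level f \<eta> x k) (q k)"
    by simp_all
qed

text \<open>Raising the level shrinks the upper level set, and an accepted point lies in the
  component of its predecessor. Thus a component confined near the mode confines all later
  ones.\<close>

lemma alg_run_component_mono:
  assumes run: "alg_run f \<eta> x q m" and "0 < \<eta>" "k \<le> j" "j \<le> m"
  shows "level_component f (alg_level f \<eta> x j) (q j) \<subseteq> level_component f (alg_level f \<eta> x k) (q k)"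
  using \<open>k \<le> j\<close> \<open>j \<le> m\<close>
proof (induction j rule: dec_induct)
  case (step j)
  let ?U = "\<lambda>k. upper_level_set f (alg_level f \<eta> x k)"
  have "?U (Suc j) \<subseteq> ?U j"
    using \<open>0 < \<eta>\<close> by (auto simp: upper_level_set_def alg_level_def algebra_simps)
  then have "connected_component_set (?U (Suc j)) (q (Suc j))
      \<subseteq> connected_component_set (?U j) (q (Suc j))"
    by (rule connected_component_mono)
  also have "\<dots> = connected_component_set (?U j) (q j)"
    using alg_run_SucD(2)[OF run, of j] step.prems connected_component_eq
    unfolding level_component_def by (metis Suc_le_lessD)
  finally show ?case
    using step unfolding level_component_def by auto
qed simp

lemma alg_run_in_component:
  assumes "alg_run f \<eta> x q m" "0 < \<eta>" "k \<le> j" "j \<le> m"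
  shows "q j \<in> level_component f (alg_level f \<eta> x k) (q k)"
proof -
  have "q j \<in> level_component f (alg_level f \<eta> x j) (q j)"
    using alg_run_level[OF assms(1,4)] by (simp add: level_component_def upper_level_set_def)
  with alg_run_component_mono[OF assms] show ?thesis by blast
qed

text \<open>The level reached after \<open>m\<close> steps is a value of \<open>f\<close>, hence at
  most \<open>M\<close>.\<close>

lemma alg_run_length_le:
  assumes "\<And>y. f y \<le> M" "alg_run f \<eta> x q m" "0 < \<eta>"
  shows "real m \<le> (M - f x) / \<eta>"
  using alg_run_level[OF assms(2), of m] assms(1)[of "q m"] assms(3)
  by (simp add: alg_level_def field_simps)

lemma alg_run_not_infinite:
  assumes "\<And>y. f y \<le> M" "0 < \<eta>"
  shows "\<not> (\<forall>m. alg_run f \<eta> x q m)"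
  using alg_run_length_le[OF assms(1) _ assms(2)] reals_Archimedean2[of "(M - f x) / \<eta>"]
  by (meson not_le)

text \<open>A run of maximal length cannot be extended, hence stops.\<close>

lemma alg_stops_exists:
  assumes "\<And>y. f y \<le> M" "0 < \<eta>"
  shows "\<exists>q m. alg_stops f \<eta> x q m"
proof -
  let ?P = "\<lambda>m. \<exists>q. alg_run f \<eta> x q m"
  have "?P 0"
    by (auto simp: alg_run_def)
  moreover have "m \<le> nat \<lceil>(M - f x) / \<eta>\<rceil>" if "?P m" for m
    using alg_run_length_le[OF assms(1) _ assms(2)] that
    by (metis le_nat_iff le_of_int_ceiling of_nat_0_le_iff order_trans real_nat_ceiling_ge of_nat_le_iff)
  ultimately obtain m where "?P m" and max: "\<And>n. ?P n \<Longrightarrow> n \<le> m"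
    using Nat.ex_has_greatest_nat[of ?P 0] by (metis (mono_tags, lifting))
  then obtain q where run: "alg_run f \<eta> x q m"
    by blast
  let ?S = "level_set f (alg_level f \<eta> x (m + 1))"
  have "p \<notin> level_component f (alg_level f \<eta> x m) (q m)" if p: "p \<in> metric_projections (q m) ?S" for p
  proof
    assume "p \<in> level_component f (alg_level f \<eta> x m) (q m)"
    then have "alg_run f \<eta> x (q(Suc m := p)) (Suc m)"
      using run p unfolding alg_run_def by (auto simp: le_Suc_eq)
    then show False
      using max[of "Suc m"] by auto
  qed
  \<comment> \<open>If the next level set is nonempty, a projection onto it exists, and by the
    preceding step it is rejected.\<close>
  then show ?thesis
    using run metric_projections_level_set_nonempty[of "alg_level f \<eta> x (m + 1)" "q m"]
    unfolding alg_stops_def by blast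
qed

section \<open>Flow lines and the implicit Euler scheme\<close>

text \<open>The initial condition is left out so that flow lines can be compared from any common
  time and constant ones are included.\<close>

definition flow_line :: "(real \<Rightarrow> 'a) \<Rightarrow> bool" where
  "flow_line \<gamma> \<longleftrightarrow> (\<forall>t\<ge>0. (\<gamma> has_vector_derivative g (\<gamma> t)) (at t within {0..}))"

lemma flow_line_continuous:
  assumes "flow_line \<gamma>"
  shows "continuous_on {0..} \<gamma>"
  using assms unfolding flow_line_def
  by (meson atLeast_iff continuous_on_eq_continuous_within has_vector_derivative_continuous)

text \<open>Gronwall in both time directions: the squared distance \<open>u\<close> satisfies
  \<open>\<bar>u'\<bar> \<le> 2 * L * u\<close>, so \<open>exp (2 * L * t) * u t\<close> is
  nondecreasing and \<open>exp (- (2 * L * t)) * u t\<close> nonincreasing. A zero at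
  \<open>t0\<close> spreads backwards by the first and forwards by the second.\<close>

lemma flow_line_unique:
  assumes \<alpha>: "flow_line \<alpha>" and \<beta>: "flow_line \<beta>" and "\<alpha> t0 = \<beta> t0" "0 \<le> t0" "0 \<le> t"
  shows "\<alpha> t = \<beta> t"
proof -
  define u where "u t = (\<alpha> t - \<beta> t) \<bullet> (\<alpha> t - \<beta> t)" for t
  define u' where "u' t = 2 * ((\<alpha> t - \<beta> t) \<bullet> (g (\<alpha> t) - g (\<beta> t)))" for t
  have cont: "continuous_on {0..} u"
    unfolding u_def by (intro continuous_intros flow_line_continuous \<alpha> \<beta>)
  have der: "(u has_real_derivative u' t) (at t)" if "t > 0" for t
  proof -
    have "at t within {0..} = at t"
      using that by (intro at_within_interior) (simp add: interior_real_atLeast)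
    then have "(\<alpha> has_vector_derivative g (\<alpha> t)) (at t)" "(\<beta> has_vector_derivative g (\<beta> t)) (at t)"
      using \<alpha> \<beta> that unfolding flow_line_def by (metis less_imp_le)+
    then have "((\<lambda>t. \<alpha> t - \<beta> t) has_derivative (\<lambda>h. h *\<^sub>R (g (\<alpha> t) - g (\<beta> t)))) (at t)"
      unfolding has_vector_derivative_def[symmetric] by (rule has_vector_derivative_diff)
    from has_derivative_inner[OF this this] show ?thesis
      unfolding u_def u'_def
      by (rule has_derivative_imp_has_field_derivative) (simp add: inner_commute algebra_simps)
  qed
  have u': "\<bar>u' t\<bar> \<le> 2 * L * u t" for t
  proof -
    have "\<bar>(\<alpha> t - \<beta> t) \<bullet> (g (\<alpha> t) - g (\<beta> t))\<bar> \<le> norm (\<alpha> t - \<beta> t) * (L * norm (\<alpha> t - \<beta> t))"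
      using Cauchy_Schwarz_ineq2 lipschitz by (meson mult_left_mono norm_ge_zero order_trans)
    then show ?thesis
      by (simp add: u_def u'_def dot_square_norm power2_eq_square abs_mult mult_ac)
  qed
  have increasing: "exp (2 * L * a) * u a \<le> exp (2 * L * b) * u b" if "0 \<le> a" "a \<le> b" for a b
  proof (rule DERIV_nonneg_imp_increasing_open[OF \<open>a \<le> b\<close>])
    fix s assume "a < s" "s < b"
    then have "((\<lambda>t. exp (2 * L * t) * u t) has_real_derivative
        exp (2 * L * s) * (2 * L * u s + u' s)) (at s)"
      using that by (auto intro!: derivative_eq_intros der simp: algebra_simps)
    moreover have "2 * L * u s + u' s \<ge> 0"
      using u'[of s] by linarith
    ultimately show "\<exists>y. ((\<lambda>t. exp (2 * L * t) * u t) has_real_derivative y) (at s) \<and> 0 \<le> y"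
      by (metis exp_ge_zero mult_nonneg_nonneg)
  next
    show "continuous_on {a..b} (\<lambda>t. exp (2 * L * t) * u t)"
      using that by (intro continuous_intros continuous_on_subset[OF cont]) auto
  qed
  \<comment> \<open>Negated, so that the same monotonicity rule applies.\<close>
  have decreasing: "- (exp (- (2 * L * a)) * u a) \<le> - (exp (- (2 * L * b)) * u b)"
    if "0 \<le> a" "a \<le> b" for a b
  proof (rule DERIV_nonneg_imp_increasing_open[OF \<open>a \<le> b\<close>])
    fix s assume "a < s" "s < b"
    then have "((\<lambda>t. - (exp (- (2 * L * t)) * u t)) has_real_derivative
        exp (- (2 * L * s)) * (2 * L * u s - u' s)) (at s)"
      using that by (auto intro!: derivative_eq_intros der simp: algebra_simps)
    moreover have "2 * L * u s - u' s \<ge> 0"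
      using u'[of s] by linarith
    ultimately show "\<exists>y. ((\<lambda>t. - (exp (- (2 * L * t)) * u t)) has_real_derivative y) (at s) \<and> 0 \<le> y"
      by (metis exp_ge_zero mult_nonneg_nonneg)
  next
    show "continuous_on {a..b} (\<lambda>t. - (exp (- (2 * L * t)) * u t))"
      using that by (intro continuous_intros continuous_on_subset[OF cont]) auto
  qed
  have "u t0 = 0"
    using assms(3) by (simp add: u_def)
  then have "u t \<le> 0"
    using increasing[of t t0] decreasing[of t0 t] assms(4,5)
    by (cases "t \<le> t0") (auto simp: mult_le_0_iff)
  then have "u t = 0"
    unfolding u_def using inner_ge_zero antisym by blast
  then show ?thesis
    by (simp add: u_def)
qed

text \<open>The constant line at a critical point is a flow line, so by uniqueness in both
  directions no other flow line reaches that point in finite time.\<close>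

lemma flow_line_noncritical:
  assumes \<gamma>: "flow_line \<gamma>" and "0 \<le> t" "g (\<gamma> t) = 0" "0 \<le> s"
  shows "\<gamma> s = \<gamma> t"
proof -
  have "flow_line (\<lambda>_. \<gamma> t)"
    using assms(3) by (simp add: flow_line_def)
  then show ?thesis
    using flow_line_unique[OF \<gamma>] assms by blast
qed

lemma flow_line_lipschitz:
  assumes \<gamma>: "flow_line \<gamma>" and G: "\<And>y. norm (g y) \<le> G" and "0 \<le> a" "0 \<le> b"
  shows "norm (\<gamma> b - \<gamma> a) \<le> G * \<bar>b - a\<bar>"
proof -
  have "norm (\<gamma> b - \<gamma> a) \<le> G * norm (b - a)"
  proof (rule differentiable_bound[of "{0..}" \<gamma> "\<lambda>t h. h *\<^sub>R g (\<gamma> t)"])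
    fix t :: real assume "t \<in> {0..}"
    then show "(\<gamma> has_derivative (\<lambda>h. h *\<^sub>R g (\<gamma> t))) (at t within {0..})"
      using \<gamma> by (simp add: flow_line_def has_vector_derivative_def)
    show "onorm (\<lambda>h. h *\<^sub>R g (\<gamma> t)) \<le> G"
      using mult_right_mono[OF G[of "\<gamma> t"] abs_ge_zero] by (intro onorm_le) (simp add: mult.commute)
  qed (use assms in auto)
  then show ?thesis by simp
qed

text \<open>The projection step \<open>p - q = \<tau> g p\<close> is an implicit Euler step of length \<open>\<tau>\<close>.\<close>

lemma implicit_euler_step:
  assumes \<gamma>: "flow_line \<gamma>" and G: "\<And>y. norm (g y) \<le> G"
    and step: "p - q = \<tau> *\<^sub>R g p" and "0 \<le> s" "0 \<le> \<tau>" "2 * L * \<tau> \<le> 1"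
  shows "norm (p - \<gamma> (s + \<tau>)) \<le> exp (2 * L * \<tau>) * (norm (q - \<gamma> s) + L * G * \<tau>\<^sup>2)"
proof -
  let ?b = "s + \<tau>"
  define e where "e = norm (p - \<gamma> ?b)"
  define e0 where "e0 = norm (q - \<gamma> s) + L * G * \<tau>\<^sup>2"
  have "G \<ge> 0"
    using order_trans[OF norm_ge_zero G] .
  then have "e0 \<ge> 0"
    using L_pos by (simp add: e0_def)
  \<comment> \<open>The linearization uses the velocity at the right end of the interval, because
    the scheme evaluates \<open>g\<close> at the new point.\<close>
  have lin: "norm (\<gamma> ?b - \<gamma> s - (?b - s) *\<^sub>R g (\<gamma> ?b)) \<le> norm (?b - s) * (L * (G * \<tau>))"
  proof (rule vector_differentiable_bound_linearization[where S = "{s..?b}"])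
    fix t assume t: "t \<in> {s..?b}"
    then have "t \<ge> 0"
      using assms(4) by auto
    then have "(\<gamma> has_vector_derivative g (\<gamma> t)) (at t within {0..})"
      using \<gamma> by (simp add: flow_line_def)
    then show "(\<gamma> has_vector_derivative g (\<gamma> t)) (at t within {s..?b})"
      by (rule has_vector_derivative_within_subset) (use assms(4) in auto)
    have "norm (\<gamma> t - \<gamma> ?b) \<le> G * \<bar>t - ?b\<bar>"
      using flow_line_lipschitz[OF \<gamma> G] \<open>t \<ge> 0\<close> assms by simp
    also have "\<dots> \<le> G * \<tau>"
      using t \<open>G \<ge> 0\<close> by (intro mult_left_mono) auto
    finally show "norm (g (\<gamma> t) - g (\<gamma> ?b)) \<le> L * (G * \<tau>)"
      using lipschitz L_pos by (meson mult_left_mono less_imp_le order_trans)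
  qed (use assms in \<open>auto simp: closed_segment_eq_real_ivl\<close>)
  have "p - \<gamma> ?b = (q - \<gamma> s) + \<tau> *\<^sub>R (g p - g (\<gamma> ?b)) - (\<gamma> ?b - \<gamma> s - \<tau> *\<^sub>R g (\<gamma> ?b))"
    unfolding scaleR_diff_right step[symmetric] by simp
  then have "e \<le> norm (q - \<gamma> s) + norm (\<tau> *\<^sub>R (g p - g (\<gamma> ?b)))
      + norm (\<gamma> ?b - \<gamma> s - \<tau> *\<^sub>R g (\<gamma> ?b))"
    unfolding e_def by (smt (verit, ccfv_threshold) norm_triangle_ineq norm_triangle_ineq4)
  also have "norm (\<tau> *\<^sub>R (g p - g (\<gamma> ?b))) \<le> \<tau> * (L * e)"
    using lipschitz[of p "\<gamma> ?b"] \<open>0 \<le> \<tau>\<close> by (simp add: e_def mult_left_mono)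
  also have "norm (\<gamma> ?b - \<gamma> s - \<tau> *\<^sub>R g (\<gamma> ?b)) \<le> L * G * \<tau>\<^sup>2"
    using lin \<open>0 \<le> \<tau>\<close> by (simp add: power2_eq_square mult_ac)
  finally have "e * (1 - L * \<tau>) \<le> e0"
    by (simp add: e0_def algebra_simps)
  moreover have Lt: "0 \<le> L * \<tau>" "2 * (L * \<tau>) \<le> 1"
    using L_pos assms by auto
  \<comment> \<open>Since \<open>L * \<tau> \<le> 1 / 2\<close>, the inverse of
    \<open>1 - L * \<tau>\<close> is at most \<open>1 + 2 * (L * \<tau>)\<close>; this resolves the
    error \<open>e\<close> that appears on both sides.\<close>
  moreover have "1 \<le> (1 + 2 * (L * \<tau>)) * (1 - L * \<tau>)"
  proof -
    have "0 \<le> (L * \<tau>) * (1 - 2 * (L * \<tau>))"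
      using Lt by simp
    then show ?thesis by (simp add: algebra_simps)
  qed
  moreover have "0 \<le> e"
    by (simp add: e_def)
  ultimately have "1 * e \<le> (1 + 2 * (L * \<tau>)) * (1 - L * \<tau>) * e"
    "(1 + 2 * (L * \<tau>)) * (e * (1 - L * \<tau>)) \<le> (1 + 2 * (L * \<tau>)) * e0"
    by (intro mult_right_mono mult_left_mono; simp)+
  then have "e \<le> (1 + 2 * (L * \<tau>)) * e0"
    by (simp only: mult_ac mult_1)
  also have "\<dots> \<le> exp (2 * L * \<tau>) * e0"
    using exp_ge_add_one_self[of "2 * L * \<tau>"] \<open>e0 \<ge> 0\<close> by (intro mult_right_mono) (simp_all add: mult.assoc)
  finally show ?thesis
    by (simp add: e_def e0_def)
qed

text \<open>Discrete Gronwall: each step adds a local error of at most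
  \<open>L * G * D * \<tau> k\<close> and multiplies the accumulated error by
  \<open>exp (2 * L * \<tau> k)\<close>. The factors combine to the exponential of the total time,
  and the bound is of first order in the largest step \<open>D\<close>.\<close>

lemma implicit_euler_error:
  assumes \<gamma>: "flow_line \<gamma>" and G: "\<And>y. norm (g y) \<le> G"
    and step: "\<And>k. k < n \<Longrightarrow> q (Suc k) - q k = \<tau> k *\<^sub>R g (q (Suc k))"
    and \<tau>: "\<And>k. k < n \<Longrightarrow> 0 \<le> \<tau> k \<and> \<tau> k \<le> D" and D: "2 * L * D \<le> 1"
    and "q 0 = \<gamma> 0"
  shows "norm (q n - \<gamma> (\<Sum>i<n. \<tau> i)) \<le> L * G * D * (\<Sum>i<n. \<tau> i) * exp (2 * L * (\<Sum>i<n. \<tau> i))"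
  using step \<tau>
proof (induction n)
  case 0
  then show ?case using assms(6) by simp
next
  case (Suc n)
  define s where "s = (\<Sum>i<n. \<tau> i)"
  have s: "0 \<le> s"
    unfolding s_def using Suc.prems(2) by (intro sum_nonneg) auto
  have t: "0 \<le> \<tau> n" "\<tau> n \<le> D"
    using Suc.prems(2) by auto
  have "L * \<tau> n \<le> L * D"
    using t(2) L_pos by simp
  then have "2 * L * \<tau> n \<le> 1"
    using D by linarith
  then have "norm (q (Suc n) - \<gamma> (s + \<tau> n))
      \<le> exp (2 * L * \<tau> n) * (norm (q n - \<gamma> s) + L * G * (\<tau> n)\<^sup>2)"
    using implicit_euler_step[OF \<gamma> G Suc.prems(1)[of n] s t(1)] by simp
  also have "\<dots> \<le> exp (2 * L * \<tau> n)
      * (L * G * D * s * exp (2 * L * s) + L * G * D * \<tau> n * exp (2 * L * s))"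
  proof (intro mult_left_mono add_mono)
    show "norm (q n - \<gamma> s) \<le> L * G * D * s * exp (2 * L * s)"
      unfolding s_def using Suc.prems by (intro Suc.IH) auto
    have G0: "0 \<le> L * G"
      using order_trans[OF norm_ge_zero G] L_pos by simp
    have "L * G * (\<tau> n)\<^sup>2 \<le> L * G * (D * \<tau> n)"
      using t G0 by (intro mult_left_mono) (auto simp: power2_eq_square mult_right_mono)
    also have "\<dots> \<le> L * G * (D * \<tau> n) * exp (2 * L * s)"
    proof -
      have "0 \<le> L * G * (D * \<tau> n)"
        using t by (intro mult_nonneg_nonneg G0) auto
      moreover have "1 \<le> exp (2 * L * s)"
        using s L_pos by simp
      ultimately show ?thesis
        by (metis mult.right_neutral mult_left_mono)
    qed
    finally show "L * G * (\<tau> n)\<^sup>2 \<le> L * G * D * \<tau> n * exp (2 * L * s)"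
      by (simp add: mult_ac)
  qed auto
  also have "\<dots> = L * G * D * (s + \<tau> n) * exp (2 * L * (s + \<tau> n))"
    by (simp add: algebra_simps exp_add)
  finally show ?case
    by (simp add: s_def)
qed

section \<open>Tracking the flow line up to a finite time\<close>

text \<open>A bootstrap: while the points are close to the flow line, the gradient is bounded below,
  so the steps are short Euler steps, and the error estimate keeps the next point close. The times
  \<open>s k\<close> are the accumulated Euler step lengths.\<close>

lemma alg_stops_tracks_flow:
  assumes \<gamma>: "flow_line \<gamma>" and G: "\<And>y. norm (g y) \<le> G"
    and noncrit: "\<forall>t\<ge>0. g (\<gamma> t) \<noteq> 0" and "0 \<le> T" "0 < \<epsilon>"
  shows "\<exists>\<eta>\<^sub>0>0. \<forall>\<eta> q m. 0 < \<eta> \<longrightarrow> \<eta> \<le> \<eta>\<^sub>0 \<longrightarrow> alg_stops f \<eta> (\<gamma> 0) q m \<longrightarrow>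
      (\<exists>s n. n \<le> m \<and> s 0 = 0 \<and> T \<le> s n \<and> (\<forall>k<n. s k \<le> s (Suc k) \<and> s (Suc k) \<le> s k + \<epsilon>) \<and>
        (\<forall>k\<le>n. norm (q k - \<gamma> (s k)) \<le> \<epsilon>))"
proof -
  have G0: "0 \<le> G"
    using order_trans[OF norm_ge_zero G] .
  have "continuous_on UNIV g"
    using lipschitz L_pos
    by (intro lipschitz_on_continuous_on[of L]) (auto simp: lipschitz_on_def dist_norm)
  moreover have "continuous_on {0..T + 1} \<gamma>"
    by (rule continuous_on_subset[OF flow_line_continuous[OF \<gamma>]]) simp
  ultimately have "continuous_on {0..T + 1} (\<lambda>t. norm (g (\<gamma> t)))"
    by (intro continuous_on_norm) (rule continuous_on_compose2, auto)
  \<comment> \<open>The interval extends one unit past \<open>T\<close> to leave room for the step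
    that passes \<open>T\<close>.\<close>
  then obtain t0 where t0: "t0 \<in> {0..T + 1}"
    "\<And>t. t \<in> {0..T + 1} \<Longrightarrow> norm (g (\<gamma> t0)) \<le> norm (g (\<gamma> t))"
    using continuous_attains_inf[of "{0..T + 1}" "\<lambda>t. norm (g (\<gamma> t))"] \<open>0 \<le> T\<close> by auto
  \<comment> \<open>Half of the minimum: a point within \<open>\<delta>\<close> of the flow line
    loses at most \<open>L * \<delta> \<le> c\<close> of \<open>2 * c\<close>.\<close>
  define c where "c = norm (g (\<gamma> t0)) / 2"
  have c: "c > 0"
    using noncrit t0(1) by (simp add: c_def)
  define \<delta> where "\<delta> = min \<epsilon> (c / L)"
  have \<delta>: "\<delta> > 0" "\<delta> \<le> \<epsilon>" "L * \<delta> \<le> c"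
    using \<open>0 < \<epsilon>\<close> c L_pos by (auto simp: \<delta>_def min_def field_simps)
  \<comment> \<open>The factor of \<open>D\<close> in the Euler error over total time
    \<open>T + 1\<close>.\<close>
  define E where "E = L * G * (T + 1) * exp (2 * L * (T + 1))"
  have E: "E \<ge> 0"
    using G0 L_pos \<open>0 \<le> T\<close> by (simp add: E_def)
  \<comment> \<open>The four bounds limit the overshoot past \<open>T\<close>, limit the gaps
    between the times, meet the step condition of the Euler estimate, and keep the error below
    \<open>\<delta>\<close>; \<open>E + 1\<close> avoids division by zero.\<close>
  define D0 where "D0 = Min {1, \<epsilon>, 1 / (2 * L), \<delta> / (E + 1)}"
  have D0: "D0 > 0"
    using \<open>0 < \<epsilon>\<close> c L_pos \<delta> E by (simp add: D0_def)
  have D0_le: "D0 \<le> 1" "D0 \<le> \<epsilon>" "2 * L * D0 \<le> 1" "E * D0 \<le> \<delta>" "L * D0 \<le> 1"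
  proof -
    show "D0 \<le> 1" "D0 \<le> \<epsilon>"
      by (simp_all add: D0_def)
    have "D0 \<le> 1 / (2 * L)"
      by (simp add: D0_def)
    then show "2 * L * D0 \<le> 1"
      using L_pos by (simp add: field_simps)
    then show "L * D0 \<le> 1"
      using L_pos D0 by (simp add: mult.assoc)
    have "D0 \<le> \<delta> / (E + 1)"
      by (simp add: D0_def)
    then have "D0 * (E + 1) \<le> \<delta>"
      using E by (simp add: pos_le_divide_eq)
    then show "E * D0 \<le> \<delta>"
      using D0 by (simp add: algebra_simps)
  qed
  define \<eta>\<^sub>0 where "\<eta>\<^sub>0 = c\<^sup>2 * D0 / 4"
  have "\<eta>\<^sub>0 > 0"
    using c D0 by (simp add: \<eta>\<^sub>0_def)
  show ?thesis
  proof (intro exI[of _ \<eta>\<^sub>0] conjI[OF \<open>\<eta>\<^sub>0 > 0\<close>] allI impI)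
    fix \<eta> q m
    assume \<eta>: "0 < \<eta>" "\<eta> \<le> \<eta>\<^sub>0" and stops: "alg_stops f \<eta> (\<gamma> 0) q m"
    have run: "alg_run f \<eta> (\<gamma> 0) q m"
      using stops by (simp add: alg_stops_def)
    have q0: "q 0 = \<gamma> 0"
      using run by (simp add: alg_run_def)
    \<comment> \<open>A step of length at most \<open>2 * \<eta> / c\<close>, divided by a gradient
      norm of at least \<open>c / 2\<close>.\<close>
    define D where "D = 4 * \<eta> / c\<^sup>2"
    have D: "0 < D" "D \<le> D0"
      using \<eta> c by (auto simp: D_def \<eta>\<^sub>0_def field_simps)
    have \<eta>_le: "4 * L * \<eta> \<le> c\<^sup>2"
    proof -
      have "L * D \<le> 1"
        using D(2) D0_le(5) L_pos by (meson less_imp_le mult_left_mono order_trans)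
      then show ?thesis
        using c by (simp add: D_def field_simps)
    qed
    have LD: "2 * L * D \<le> 1"
      using mult_left_mono[OF D(2), of "2 * L"] D0_le(3) L_pos by linarith
    define \<tau> where "\<tau> k = norm (q (Suc k) - q k) / norm (g (q (Suc k)))" for k
    define s where "s k = (\<Sum>i<k. \<tau> i)" for k
    have s_Suc: "s (Suc k) = s k + \<tau> k" for k
      by (simp add: s_def)
    have \<tau>0: "\<tau> k \<ge> 0" for k
      by (simp add: \<tau>_def)
    have s0: "s k \<ge> 0" for k
      unfolding s_def using \<tau>0 by (simp add: sum_nonneg)
    have gradient_ge: "norm (g (q k)) \<ge> c"
      if "s k \<le> T + 1" "norm (q k - \<gamma> (s k)) \<le> \<delta>" for k
    proof -
      have "2 * c \<le> norm (g (\<gamma> (s k)))"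
        using t0(2)[of "s k"] that(1) s0[of k] by (simp add: c_def)
      moreover have "L * norm (\<gamma> (s k) - q k) \<le> c"
        using mult_left_mono[OF that(2), of L] \<delta>(3) L_pos
        unfolding norm_minus_commute[of "\<gamma> (s k)"] by linarith
      ultimately show ?thesis
        using norm_gradient_ge[of "\<gamma> (s k)" "q k"] by linarith
    qed
    have step: "q (Suc k) - q k = \<tau> k *\<^sub>R g (q (Suc k)) \<and> \<tau> k \<le> D"
      if "k < m" "norm (g (q k)) \<ge> c" for k
    proof -
      note * = metric_projection_step[OF c that(2) \<eta>(1) \<eta>_le alg_run_SucD(1)[OF run that(1)]]
      have "\<tau> k \<le> (2 * \<eta> / c) / (c / 2)"
        unfolding \<tau>_def using *(1,2) c \<eta>(1) by (intro frac_le) auto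
      also have "\<dots> = D"
        using c by (simp add: D_def power2_eq_square)
      finally show ?thesis
        using *(3) unfolding \<tau>_def by blast
    qed
    have track: "s k \<le> T + 1 \<and> norm (q k - \<gamma> (s k)) \<le> \<delta> \<and>
        (\<forall>j<k. q (Suc j) - q j = \<tau> j *\<^sub>R g (q (Suc j)) \<and> \<tau> j \<le> D)"
      if "k \<le> m" "\<forall>j<k. s j \<le> T" for k
      using that
    proof (induction k)
      case 0
      then show ?case
        using q0 \<delta>(1) \<open>0 \<le> T\<close> by (simp add: s_def)
    next
      case (Suc k)
      then have IH: "s k \<le> T + 1" "norm (q k - \<gamma> (s k)) \<le> \<delta>"
        "\<forall>j<k. q (Suc j) - q j = \<tau> j *\<^sub>R g (q (Suc j)) \<and> \<tau> j \<le> D"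
        by auto
      have steps: "\<forall>j<Suc k. q (Suc j) - q j = \<tau> j *\<^sub>R g (q (Suc j)) \<and> \<tau> j \<le> D"
        using IH(3) step[of k] gradient_ge[OF IH(1,2)] Suc.prems(1) by (auto simp: less_Suc_eq)
      have "s k \<le> T" "\<tau> k \<le> D"
        using Suc.prems(2) steps by auto
      then have sT: "s (Suc k) \<le> T + 1"
        using D(2) D0_le(1) by (simp add: s_Suc)
      have "norm (q (Suc k) - \<gamma> (s (Suc k)))
          \<le> L * G * D * s (Suc k) * exp (2 * L * s (Suc k))"
        unfolding s_def using steps \<tau>0 LD q0 by (intro implicit_euler_error[OF \<gamma> G]) auto
      also have "\<dots> \<le> L * G * D * (T + 1) * exp (2 * L * (T + 1))"
        using sT s0[of "Suc k"] G0 L_pos D(1) \<open>0 \<le> T\<close> by (intro mult_mono) auto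
      also have "\<dots> = E * D"
        by (simp add: E_def)
      also have "\<dots> \<le> E * D0"
        using D(2) E by (rule mult_left_mono)
      also have "\<dots> \<le> \<delta>"
        by (rule D0_le)
      finally show ?case
        using steps sT by blast
    qed
    \<comment> \<open>If all times were at most \<open>T\<close>, the gradient at \<open>q m\<close>
      would still be large: the next level set would be nonempty and every projection onto it
      accepted, so the run could not stop.\<close>
    have "\<exists>n. n \<le> m \<and> T < s n"
    proof (rule ccontr)
      assume "\<not> (\<exists>n. n \<le> m \<and> T < s n)"
      then have "\<forall>j<m. s j \<le> T"
        by (meson less_imp_le not_less)
      then have big: "norm (g (q m)) \<ge> c"
        using track[of m] gradient_ge[of m] by simp
      have level: "alg_level f \<eta> (\<gamma> 0) (m + 1) = f (q m) + \<eta>" "alg_level f \<eta> (\<gamma> 0) m = f (q m)"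
        using alg_run_level[OF run, of m] by (simp_all add: alg_level_def algebra_simps)
      show False
        using stops metric_projection_step(4)[OF c big \<eta>(1) \<eta>_le] level_set_near[OF c big \<eta>(1) \<eta>_le]
        unfolding alg_stops_def level by (metis empty_iff)
    qed
    \<comment> \<open>For the least such \<open>n\<close> all earlier times are at most
      \<open>T\<close>, as \<open>track\<close> requires.\<close>
    then obtain n where n: "n \<le> m \<and> T < s n" and least: "\<And>j. j < n \<Longrightarrow> \<not> (j \<le> m \<and> T < s j)"
      using exists_least_iff[of "\<lambda>n. n \<le> m \<and> T < s n"] by auto
    have below: "s j \<le> T" if "j < n" for j
      using least[OF that] n that by auto
    have "norm (q k - \<gamma> (s k)) \<le> \<epsilon>" if "k \<le> n" for k
      using track[of k] below n that \<delta>(2) by fastforce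
    moreover have "s k \<le> s (Suc k) \<and> s (Suc k) \<le> s k + \<epsilon>" if "k < n" for k
    proof -
      have "\<tau> k \<le> D"
        using track[of n] below n that by auto
      then show ?thesis
        using \<tau>0[of k] D(2) D0_le(2) by (simp add: s_Suc)
    qed
    moreover have "s 0 = 0"
      by (simp add: s_def)
    ultimately show "\<exists>s n. n \<le> m \<and> s 0 = 0 \<and> T \<le> s n \<and>
        (\<forall>k<n. s k \<le> s (Suc k) \<and> s (Suc k) \<le> s k + \<epsilon>) \<and> (\<forall>k\<le>n. norm (q k - \<gamma> (s k)) \<le> \<epsilon>)"
      using n by (intro exI[of _ s] exI[of _ n]) auto
  qed
qed

text \<open>Tracking up to a time after which the flow line stays near its limit; for a constant
  flow line \<open>n = 0\<close> serves.\<close>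

lemma alg_stops_tracks_flow_to_limit:
  assumes \<gamma>: "flow_line \<gamma>" and G: "\<And>y. norm (g y) \<le> G"
    and lim: "(\<gamma> \<longlongrightarrow> z) at_top" and "0 < \<epsilon>"
  shows "\<exists>\<eta>\<^sub>0>0. \<forall>\<eta> q m. 0 < \<eta> \<longrightarrow> \<eta> \<le> \<eta>\<^sub>0 \<longrightarrow> alg_stops f \<eta> (\<gamma> 0) q m \<longrightarrow>
      (\<exists>s n. n \<le> m \<and> s 0 = 0 \<and> (\<forall>k<n. s k \<le> s (Suc k) \<and> s (Suc k) \<le> s k + \<epsilon>) \<and>
        (\<forall>k\<le>n. norm (q k - \<gamma> (s k)) \<le> \<epsilon>) \<and> (\<forall>t\<ge>s n. norm (\<gamma> t - z) \<le> \<epsilon>))"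
proof (cases "\<exists>t\<ge>0. g (\<gamma> t) = 0")
  case True
  then obtain t where t: "t \<ge> 0" "g (\<gamma> t) = 0"
    by blast
  have const: "\<gamma> s = \<gamma> t" if "s \<ge> 0" for s
    using flow_line_noncritical[OF \<gamma> t that] .
  have "\<forall>\<^sub>F s in at_top. \<gamma> s = \<gamma> t"
    using eventually_ge_at_top[of 0] by eventually_elim (rule const)
  with lim have "((\<lambda>_::real. \<gamma> t) \<longlongrightarrow> z) at_top"
    by (rule Lim_transform_eventually)
  then have z: "\<gamma> t = z"
    by (simp add: tendsto_const_iff)
  show ?thesis
  proof (intro exI[of _ 1] conjI[OF zero_less_one] allI impI)
    fix \<eta> q m assume "alg_stops f \<eta> (\<gamma> 0) q m"
    then have "q 0 = \<gamma> 0"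
      by (simp add: alg_stops_def alg_run_def)
    then show "\<exists>s n. n \<le> m \<and> s 0 = 0 \<and> (\<forall>k<n. s k \<le> s (Suc k) \<and> s (Suc k) \<le> s k + \<epsilon>) \<and>
        (\<forall>k\<le>n. norm (q k - \<gamma> (s k)) \<le> \<epsilon>) \<and> (\<forall>t\<ge>s n. norm (\<gamma> t - z) \<le> \<epsilon>)"
      using const z \<open>0 < \<epsilon>\<close> by (intro exI[of _ "\<lambda>_. 0"] exI[of _ 0]) auto
  qed
next
  case False
  then have noncrit: "\<forall>t\<ge>0. g (\<gamma> t) \<noteq> 0"
    by blast
  obtain T0 where T0: "\<And>t. t \<ge> T0 \<Longrightarrow> dist (\<gamma> t) z < \<epsilon>"
    using tendstoD[OF lim \<open>0 < \<epsilon>\<close>] unfolding eventually_at_top_linorder by blast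
  define T where "T = max T0 0"
  have T: "0 \<le> T" "\<And>t. t \<ge> T \<Longrightarrow> dist (\<gamma> t) z < \<epsilon>"
    using T0 by (auto simp: T_def)
  obtain \<eta>\<^sub>0 where \<eta>\<^sub>0: "\<eta>\<^sub>0 > 0"
    "\<forall>\<eta> q m. 0 < \<eta> \<longrightarrow> \<eta> \<le> \<eta>\<^sub>0 \<longrightarrow> alg_stops f \<eta> (\<gamma> 0) q m \<longrightarrow>
      (\<exists>s n. n \<le> m \<and> s 0 = 0 \<and> T \<le> s n \<and>
        (\<forall>k<n. s k \<le> s (Suc k) \<and> s (Suc k) \<le> s k + \<epsilon>) \<and>
        (\<forall>k\<le>n. norm (q k - \<gamma> (s k)) \<le> \<epsilon>))"
    using alg_stops_tracks_flow[OF \<gamma> G noncrit T(1) \<open>0 < \<epsilon>\<close>] by (elim exE conjE)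
  show ?thesis
  proof (intro exI[of _ \<eta>\<^sub>0] conjI[OF \<eta>\<^sub>0(1)] allI impI)
    fix \<eta> q m assume "0 < \<eta>" "\<eta> \<le> \<eta>\<^sub>0" "alg_stops f \<eta> (\<gamma> 0) q m"
    from \<eta>\<^sub>0(2)[rule_format, OF this] obtain s n where
      sn: "n \<le> m" "s 0 = 0" "T \<le> s n" "\<forall>k<n. s k \<le> s (Suc k) \<and> s (Suc k) \<le> s k + \<epsilon>"
      "\<forall>k\<le>n. norm (q k - \<gamma> (s k)) \<le> \<epsilon>"
      by blast
    have "\<forall>t\<ge>s n. norm (\<gamma> t - z) \<le> \<epsilon>"
      using T(2) sn(3) by (auto simp: dist_norm intro: less_imp_le)
    with sn show "\<exists>s n. n \<le> m \<and> s 0 = 0 \<and> (\<forall>k<n. s k \<le> s (Suc k) \<and> s (Suc k) \<le> s k + \<epsilon>) \<and>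
        (\<forall>k\<le>n. norm (q k - \<gamma> (s k)) \<le> \<epsilon>) \<and> (\<forall>t\<ge>s n. norm (\<gamma> t - z) \<le> \<epsilon>)"
      by blast
  qed
qed

end

section \<open>Hausdorff distance between polygonal line and curve\<close>

lemma hausdorff_distance_le:
  assumes "\<And>a. a \<in> A \<Longrightarrow> \<exists>b\<in>B. dist a b \<le> r" "\<And>b. b \<in> B \<Longrightarrow> \<exists>a\<in>A. dist a b \<le> r"
  shows "hausdorff_distance A B \<le> ennreal r"
proof -
  have "(INF b\<in>B. ennreal (dist a b)) \<le> ennreal r" if "a \<in> A" for a
    using assms(1)[OF that] by (meson INF_lower2 ennreal_leI)
  moreover have "(INF a\<in>A. ennreal (dist a b)) \<le> ennreal r" if "b \<in> B" for b
    using assms(2)[OF that] by (meson INF_lower2 ennreal_leI)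
  ultimately show ?thesis
    unfolding hausdorff_distance_def by (simp add: SUP_le_iff)
qed

lemma vertex_in_polygonal_line:
  assumes "k \<le> m"
  shows "q k \<in> polygonal_line q m"
proof (cases "m = 0")
  case False
  show ?thesis
  proof (cases "k = 0")
    case True
    then show ?thesis
      using False unfolding polygonal_line_def by (auto intro!: bexI[of _ 1])
  next
    case k: False
    then show ?thesis
      using False assms unfolding polygonal_line_def by (auto intro!: bexI[of _ k])
  qed
qed (use assms in \<open>simp add: polygonal_line_def\<close>)

lemma polygonal_line_cases:
  assumes "a \<in> polygonal_line q m"
  obtains "m = 0" "a = q 0" | k where "k < m" "a \<in> closed_segment (q k) (q (Suc k))"
proof (cases "m = 0")
  case False
  then obtain k where k: "k \<in> {1..m}" "a \<in> closed_segment (q (k - 1)) (q k)"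
    using assms unfolding polygonal_line_def by auto
  then have "k - 1 < m" "Suc (k - 1) = k"
    by auto
  with k(2) that(2)[of "k - 1"] show ?thesis
    by simp
qed (use assms that(1) in \<open>simp add: polygonal_line_def\<close>)

text \<open>Both sets are split at index \<open>n\<close>. Before it, consecutive times differ by at
  most \<open>\<epsilon>\<close>, so segments and arcs are close to the tracked vertices; after it,
  both sets are close to \<open>z\<close>.\<close>

lemma hausdorff_polygonal_line_le:
  fixes \<gamma> :: "real \<Rightarrow> 'a::euclidean_space"
  assumes s: "s 0 = 0" "\<And>k. k < n \<Longrightarrow> s k \<le> s (Suc k) \<and> s (Suc k) \<le> s k + \<epsilon>"
    and track: "\<And>k. k \<le> n \<Longrightarrow> norm (q k - \<gamma> (s k)) \<le> \<epsilon>"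
    and tail: "\<And>t. s n \<le> t \<Longrightarrow> norm (\<gamma> t - z) \<le> \<epsilon>"
    and lip: "\<And>a b. 0 \<le> a \<Longrightarrow> 0 \<le> b \<Longrightarrow> norm (\<gamma> b - \<gamma> a) \<le> G * \<bar>b - a\<bar>" and "0 \<le> G"
    and near: "\<And>k. n \<le> k \<Longrightarrow> k \<le> m \<Longrightarrow> q k \<in> ball z \<rho>"
    and "n \<le> m" "0 \<le> \<rho>"
  shows "hausdorff_distance (polygonal_line q m) (\<gamma> ` {0..}) \<le> ennreal ((G + 3) * \<epsilon> + \<rho>)"
proof (rule hausdorff_distance_le)
  let ?r = "(G + 3) * \<epsilon> + \<rho>"
  have \<epsilon>: "0 \<le> \<epsilon>"
    using order_trans[OF norm_ge_zero track[of 0]] by simp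
  then have r: "?r = G * \<epsilon> + 3 * \<epsilon> + \<rho>" "0 \<le> G * \<epsilon>"
    using \<open>0 \<le> G\<close> by (simp_all add: algebra_simps)
  have s0: "0 \<le> s k" if "k \<le> n" for k
    using that
  proof (induction k)
    case (Suc k)
    then show ?case using s(2)[of k] by simp
  qed (simp add: s(1))
  have G_step: "norm (\<gamma> b - \<gamma> a) \<le> G * \<epsilon>" if "0 \<le> a" "0 \<le> b" "\<bar>b - a\<bar> \<le> \<epsilon>" for a b
    using lip[OF that(1,2)] mult_left_mono[OF that(3) \<open>0 \<le> G\<close>] by linarith
  have vertex: "\<exists>b\<in>\<gamma> ` {0..}. dist (q k) b \<le> ?r" if "k \<le> n" for k
    using track[OF that] s0[OF that] r \<epsilon> \<open>0 \<le> \<rho>\<close>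
    by (intro bexI[of _ "\<gamma> (s k)"]) (auto simp: dist_norm)
  {
    fix a assume "a \<in> polygonal_line q m"
    then show "\<exists>b\<in>\<gamma> ` {0..}. dist a b \<le> ?r"
    proof (cases rule: polygonal_line_cases)
      case 1
      then show ?thesis using vertex[of 0] by simp
    next
      case (2 k)
      show ?thesis
      proof (cases "k < n")
        case True
        have "norm (\<gamma> (s (Suc k)) - \<gamma> (s k)) \<le> G * \<epsilon>"
          using s(2)[OF True] s0[of k] s0[of "Suc k"] True by (intro G_step) auto
        then have "norm (q (Suc k) - \<gamma> (s k)) \<le> \<epsilon> + G * \<epsilon>"
          using track[of "Suc k"] True
            norm_triangle_ineq[of "q (Suc k) - \<gamma> (s (Suc k))" "\<gamma> (s (Suc k)) - \<gamma> (s k)"]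
          by simp
        moreover have "norm (q k - \<gamma> (s k)) \<le> \<epsilon> + G * \<epsilon>"
          using track[of k] True r by simp
        \<comment> \<open>Balls are convex, so it suffices to place the two endpoints; the same
          holds for the late segments below.\<close>
        ultimately have "closed_segment (q k) (q (Suc k)) \<subseteq> cball (\<gamma> (s k)) (\<epsilon> + G * \<epsilon>)"
          by (intro closed_segment_subset) (auto simp: dist_norm norm_minus_commute)
        then have "dist a (\<gamma> (s k)) \<le> \<epsilon> + G * \<epsilon>"
          using 2 by (auto simp: dist_commute)
        then show ?thesis
          using s0[of k] True r \<epsilon> \<open>0 \<le> \<rho>\<close> by (intro bexI[of _ "\<gamma> (s k)"]) auto
      next
        case False
        then have "closed_segment (q k) (q (Suc k)) \<subseteq> ball z \<rho>"
          using near 2 by (intro closed_segment_subset) auto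
        then have "dist a z \<le> \<rho>"
          using 2 by (auto simp: dist_commute)
        moreover have "dist (\<gamma> (s n)) z \<le> \<epsilon>"
          using tail[of "s n"] by (simp add: dist_norm)
        ultimately have "dist a (\<gamma> (s n)) \<le> \<rho> + \<epsilon>"
          using dist_triangle2[of a "\<gamma> (s n)" z] by linarith
        then show ?thesis
          using s0[of n] r \<epsilon> by (intro bexI[of _ "\<gamma> (s n)"]) auto
      qed
    qed
  }
  fix b assume "b \<in> \<gamma> ` {0..}"
  then obtain t where t: "0 \<le> t" "b = \<gamma> t"
    by auto
  have "\<exists>k\<le>n. norm (q k - \<gamma> t) \<le> ?r"
  proof (cases "t < s n")
    case True
    \<comment> \<open>The time \<open>t\<close> lies between \<open>s k\<close> and
      \<open>s (Suc k)\<close>, at distance at most \<open>\<epsilon>\<close> from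
      \<open>s k\<close>.\<close>
    define k where "k = (GREATEST k. k \<le> n \<and> s k \<le> t)"
    have "k \<le> n \<and> s k \<le> t"
      unfolding k_def by (rule GreatestI_nat[of _ 0 n]) (use s(1) t in auto)
    then have k: "k < n" "s k \<le> t"
      using True by (auto simp: le_less)
    have "\<not> s (Suc k) \<le> t"
    proof
      assume "s (Suc k) \<le> t"
      then have "Suc k \<le> k"
        using k(1) unfolding k_def by (intro Greatest_le_nat[of _ _ n]) auto
      then show False by simp
    qed
    then have "norm (\<gamma> t - \<gamma> (s k)) \<le> G * \<epsilon>"
      using k s(2)[OF k(1)] s0[of k] t by (intro G_step) auto
    then have "norm (q k - \<gamma> t) \<le> \<epsilon> + G * \<epsilon>"
      using track[of k] k(1) norm_triangle_ineq4[of "q k - \<gamma> (s k)" "\<gamma> t - \<gamma> (s k)"] by simp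
    then show ?thesis
      using k(1) r \<epsilon> \<open>0 \<le> \<rho>\<close> by (intro exI[of _ k]) auto
  next
    case False
    \<comment> \<open>The path from \<open>q n\<close> to \<open>\<gamma> t\<close> via
      \<open>\<gamma> (s n)\<close> and \<open>z\<close> has three legs of length at most
      \<open>\<epsilon>\<close>.\<close>
    then have "norm (\<gamma> t - z) \<le> \<epsilon>" "norm (\<gamma> (s n) - z) \<le> \<epsilon>"
      using tail by auto
    then have "norm (q n - \<gamma> t) \<le> 3 * \<epsilon>"
      using track[of n] norm_triangle_ineq4[of "\<gamma> (s n) - z" "\<gamma> t - z"]
        norm_triangle_ineq[of "q n - \<gamma> (s n)" "\<gamma> (s n) - \<gamma> t"] by simp
    then show ?thesis
      using r \<open>0 \<le> \<rho>\<close> by (intro exI[of _ n]) auto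
  qed
  then show "\<exists>a\<in>polygonal_line q m. dist a b \<le> ?r"
    using vertex_in_polygonal_line \<open>n \<le> m\<close> t(2) by (metis dist_norm order_trans)
qed

section \<open>Capture at the mode and convergence\<close>

context lipschitz_gradient
begin

text \<open>Tracking brings \<open>q n\<close> within \<open>\<sigma>\<close> of \<open>z\<close>,
  where its component is trapped in the ball of radius \<open>\<rho>\<close>. Nestedness keeps all
  later points and the final component there, and \<open>z\<close> is the only critical point in
  that ball.\<close>

lemma alg_converges:
  assumes \<gamma>: "flow_line \<gamma>" and G: "\<And>y. norm (g y) \<le> G" and lim: "(\<gamma> \<longlongrightarrow> z) at_top"
    and peak: "r > 0" "\<forall>y\<in>ball z r - {z}. f y < f z \<and> g y \<noteq> 0" and "0 < \<epsilon>"
  shows "\<exists>\<eta>\<^sub>0>0. \<forall>\<eta> q m. 0 < \<eta> \<longrightarrow> \<eta> \<le> \<eta>\<^sub>0 \<longrightarrow> alg_stops f \<eta> (\<gamma> 0) q m \<longrightarrow>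
      alg_output f \<eta> (\<gamma> 0) q m = {z} \<and>
      hausdorff_distance (polygonal_line q m) (\<gamma> ` {0..}) < ennreal \<epsilon>"
proof -
  \<comment> \<open>Below \<open>r\<close>, so that the sphere lies where \<open>f\<close> is less
    than \<open>f z\<close>; at most \<open>\<epsilon> / 4\<close> for the late segments.\<close>
  define \<rho> where "\<rho> = min (r / 2) (\<epsilon> / 4)"
  have \<rho>: "0 < \<rho>" "\<rho> < r" "\<rho> \<le> \<epsilon> / 4"
    using peak(1) \<open>0 < \<epsilon>\<close> by (auto simp: \<rho>_def)
  have "f y < f z" if "y \<in> sphere z \<rho>" for y
    using that bspec[OF peak(2), of y] \<rho> by auto
  then obtain \<sigma> where \<sigma>: "\<sigma> > 0"
    "\<And>q. q \<in> ball z \<sigma> \<Longrightarrow> level_component f (f q) q \<subseteq> ball z \<rho>"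
    using level_component_captured[OF \<rho>(1)] by blast
  have G0: "0 \<le> G"
    using order_trans[OF norm_ge_zero G] .
  \<comment> \<open>The tracking error and the distance of the flow line from \<open>z\<close> add
    up to \<open>2 * \<epsilon>' < \<sigma>\<close>; the other bound leaves a Hausdorff distance of
    at most \<open>\<epsilon> / 2\<close>.\<close>
  define \<epsilon>' where "\<epsilon>' = min (\<sigma> / 3) (\<epsilon> / (4 * (G + 3)))"
  have \<epsilon>': "0 < \<epsilon>'" "2 * \<epsilon>' < \<sigma>" "(G + 3) * \<epsilon>' \<le> \<epsilon> / 4"
  proof -
    show "0 < \<epsilon>'" "2 * \<epsilon>' < \<sigma>"
      using \<sigma>(1) \<open>0 < \<epsilon>\<close> G0 by (auto simp: \<epsilon>'_def min_def)
    have "(G + 3) * \<epsilon>' \<le> (G + 3) * (\<epsilon> / (4 * (G + 3)))"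
      using G0 by (intro mult_left_mono) (auto simp: \<epsilon>'_def)
    also have "\<dots> = \<epsilon> / 4"
      using G0 by (simp add: field_simps)
    finally show "(G + 3) * \<epsilon>' \<le> \<epsilon> / 4" .
  qed
  obtain \<eta>\<^sub>0 where \<eta>\<^sub>0: "\<eta>\<^sub>0 > 0"
    "\<forall>\<eta> q m. 0 < \<eta> \<longrightarrow> \<eta> \<le> \<eta>\<^sub>0 \<longrightarrow> alg_stops f \<eta> (\<gamma> 0) q m \<longrightarrow>
      (\<exists>s n. n \<le> m \<and> s 0 = 0 \<and> (\<forall>k<n. s k \<le> s (Suc k) \<and> s (Suc k) \<le> s k + \<epsilon>') \<and>
        (\<forall>k\<le>n. norm (q k - \<gamma> (s k)) \<le> \<epsilon>') \<and> (\<forall>t\<ge>s n. norm (\<gamma> t - z) \<le> \<epsilon>'))"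
    using alg_stops_tracks_flow_to_limit[OF \<gamma> G lim \<epsilon>'(1)] by (elim exE conjE)
  show ?thesis
  proof (intro exI[of _ \<eta>\<^sub>0] conjI[OF \<eta>\<^sub>0(1)] allI impI)
    fix \<eta> q m assume \<eta>: "0 < \<eta>" "\<eta> \<le> \<eta>\<^sub>0" and stops: "alg_stops f \<eta> (\<gamma> 0) q m"
    obtain s n where sn: "n \<le> m" "s 0 = 0" "\<forall>k<n. s k \<le> s (Suc k) \<and> s (Suc k) \<le> s k + \<epsilon>'"
      "\<forall>k\<le>n. norm (q k - \<gamma> (s k)) \<le> \<epsilon>'" "\<forall>t\<ge>s n. norm (\<gamma> t - z) \<le> \<epsilon>'"
      using \<eta>\<^sub>0(2)[rule_format, OF \<eta> stops] by blast
    have run: "alg_run f \<eta> (\<gamma> 0) q m"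
      using stops by (simp add: alg_stops_def)
    have "norm (q n - \<gamma> (s n)) \<le> \<epsilon>'" "norm (\<gamma> (s n) - z) \<le> \<epsilon>'"
      using sn by auto
    then have "norm (q n - z) < \<sigma>"
      using norm_triangle_ineq[of "q n - \<gamma> (s n)" "\<gamma> (s n) - z"] \<epsilon>'(2) by simp
    then have "level_component f (f (q n)) (q n) \<subseteq> ball z \<rho>"
      by (intro \<sigma>(2)) (simp add: dist_norm norm_minus_commute)
    then have captured: "level_component f (alg_level f \<eta> (\<gamma> 0) n) (q n) \<subseteq> ball z \<rho>"
      using alg_run_level[OF run sn(1)] by simp
    have "alg_output f \<eta> (\<gamma> 0) q m = {z}"
      unfolding alg_output_def
    proof (rule maximizers_on_level_component)
      show "level_component f (alg_level f \<eta> (\<gamma> 0) m) (q m) \<subseteq> ball z \<rho>"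
        using alg_run_component_mono[OF run \<eta>(1) sn(1) order_refl] captured by blast
      show "alg_level f \<eta> (\<gamma> 0) m \<le> f (q m)"
        using alg_run_level[OF run, of m] by simp
      show "y = z" if "y \<in> ball z \<rho>" "g y = 0" for y
        using bspec[OF peak(2), of y] that \<rho>(2) by auto
    qed
    moreover have "hausdorff_distance (polygonal_line q m) (\<gamma> ` {0..})
        \<le> ennreal ((G + 3) * \<epsilon>' + \<rho>)"
    proof (rule hausdorff_polygonal_line_le[where s = s and n = n and z = z])
      show "q k \<in> ball z \<rho>" if "n \<le> k" "k \<le> m" for k
        using alg_run_in_component[OF run \<eta>(1) that] captured by blast
    qed (use sn flow_line_lipschitz[OF \<gamma> G] G0 \<rho>(1) in auto)
    moreover have "ennreal ((G + 3) * \<epsilon>' + \<rho>) < ennreal \<epsilon>"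
      using \<epsilon>'(3) \<rho>(3) \<open>0 < \<epsilon>\<close> by (intro ennreal_lessI) auto
    ultimately show "alg_output f \<eta> (\<gamma> 0) q m = {z} \<and>
        hausdorff_distance (polygonal_line q m) (\<gamma> ` {0..}) < ennreal \<epsilon>"
      by (meson le_less_trans)
  qed
qed

end

theorem theorem3p1:
  fixes f :: "'a::euclidean_space \<Rightarrow> real"
    and x x_star :: 'a
    and \<gamma> :: "real \<Rightarrow> 'a"
  assumes density: "probability_density f"
    and vanishing: "(f \<longlongrightarrow> 0) at_infinity"
    and smooth: "C2_bounded f"
    and nondegenerate: "nondegenerate_critical_points f"
    and mode: "is_mode f x_star"
    and basin: "x \<in> basin_of_attraction f x_star"
    and flow: "gradient_flow_line f x \<gamma>"
  shows "(\<exists>\<eta>\<^sub>0>0. \<forall>\<eta>. 0 < \<eta> \<and> \<eta> \<le> \<eta>\<^sub>0 \<longrightarrow> alg_returns f \<eta> x x_star) \<and>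
         (\<forall>\<epsilon>>0. \<forall>\<^sub>F \<eta> in at_right 0. \<forall>q m. alg_stops f \<eta> x q m \<longrightarrow>
           hausdorff_distance (polygonal_line q m) (\<gamma> ` {0..}) < ennreal \<epsilon>)"
proof -
  obtain L where L: "L > 0" "\<And>x y. norm (gradient f x - gradient f y) \<le> L * norm (x - y)"
    using C2_bounded_gradient_lipschitz[OF smooth] by blast
  interpret lipschitz_gradient f "gradient f" L
    using L smooth by unfold_locales (auto simp: C2_bounded_def intro: GDERIV_gradient)
  obtain M where "\<And>y. \<bar>f y\<bar> \<le> M"
    using smooth unfolding C2_bounded_def bounded_iff real_norm_def by blast
  then have M: "f y \<le> M" for y
    using abs_le_D1 by blast
  obtain G where G: "\<And>y. norm (gradient f y) \<le> G"
    using smooth unfolding C2_bounded_def bounded_iff by blast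
  have \<gamma>: "flow_line \<gamma>" and \<gamma>0: "\<gamma> 0 = x"
    using flow by (simp_all add: gradient_flow_line_def flow_line_def)
  obtain \<beta> where \<beta>: "flow_line \<beta>" "\<beta> 0 = x" "(\<beta> \<longlongrightarrow> x_star) at_top"
    using basin by (auto simp: basin_of_attraction_def gradient_flow_line_def flow_line_def)
  \<comment> \<open>The basin supplies a flow line \<open>\<beta>\<close> of its own; uniqueness
    identifies it with \<open>\<gamma>\<close> at nonnegative times and transfers the limit.\<close>
  have "\<forall>\<^sub>F t in at_top. \<beta> t = \<gamma> t"
    using eventually_ge_at_top[of 0]
    by eventually_elim (use flow_line_unique[OF \<beta>(1) \<gamma>, of 0] \<beta>(2) \<gamma>0 in auto)
  with \<beta>(3) have lim: "(\<gamma> \<longlongrightarrow> x_star) at_top"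
    by (rule Lim_transform_eventually)
  obtain e where "e > 0" "\<And>y. y \<in> ball x_star e \<Longrightarrow> f y \<le> f x_star"
    using mode unfolding is_mode_def eventually_nhds_metric by (auto simp: dist_commute)
  \<comment> \<open>A mode is critical, so its Hessian is nonsingular and the mode is an isolated
    critical point.\<close>
  then have critical: "gradient f x_star = 0"
    by (intro GDERIV_local_max_eq_0[OF gderiv[of x_star], of "ball x_star e"]) auto
  have "(gradient f has_derivative hessian f x_star) (at x_star)"
    using smooth unfolding C2_bounded_def hessian_def by (simp add: frechet_derivative_works)
  moreover have "inj (hessian f x_star)"
    using nondegenerate critical by (simp add: nondegenerate_critical_points_def bij_def)
  ultimately obtain \<rho> where "\<rho> > 0" "\<And>y. y \<in> ball x_star \<rho> \<Longrightarrow> gradient f y = 0 \<Longrightarrow> y = x_star"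
    using nonsingular_derivative_isolated_zero critical by blast
  then obtain r where r: "r > 0"
    "\<forall>y\<in>ball x_star r - {x_star}. f y < f x_star \<and> gradient f y \<noteq> 0"
    using strict_isolated_max[OF mode] by blast
  note converges = alg_converges[OF \<gamma> G lim r, unfolded \<gamma>0]
  show ?thesis
  proof (intro conjI allI impI)
    \<comment> \<open>The tolerance 1 is arbitrary: this threshold concerns only the output.\<close>
    obtain \<eta>\<^sub>0 where \<eta>\<^sub>0: "\<eta>\<^sub>0 > 0" "\<forall>\<eta> q m. 0 < \<eta> \<longrightarrow> \<eta> \<le> \<eta>\<^sub>0 \<longrightarrow> alg_stops f \<eta> x q m \<longrightarrow>
        alg_output f \<eta> x q m = {x_star} \<and>
        hausdorff_distance (polygonal_line q m) (\<gamma> ` {0..}) < ennreal 1"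
      using converges[OF zero_less_one] by (elim exE conjE)
    show "\<exists>\<eta>\<^sub>0>0. \<forall>\<eta>. 0 < \<eta> \<and> \<eta> \<le> \<eta>\<^sub>0 \<longrightarrow> alg_returns f \<eta> x x_star"
      unfolding alg_returns_def
    proof (intro exI[of _ \<eta>\<^sub>0] conjI[OF \<eta>\<^sub>0(1)] allI impI conjI)
      fix \<eta> assume \<eta>: "0 < \<eta> \<and> \<eta> \<le> \<eta>\<^sub>0"
      then show "\<exists>q m. alg_stops f \<eta> x q m" "\<not> (\<exists>q. \<forall>m. alg_run f \<eta> x q m)"
        using alg_stops_exists[OF M] alg_run_not_infinite[OF M] by auto
      show "alg_output f \<eta> x q m = {x_star}" if "alg_stops f \<eta> x q m" for q m
        using \<eta>\<^sub>0(2) \<eta> that by auto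
    qed
  next
    fix \<epsilon> :: real assume "\<epsilon> > 0"
    obtain \<eta>\<^sub>0 where \<eta>\<^sub>0: "\<eta>\<^sub>0 > 0"
      "\<forall>\<eta> q m. 0 < \<eta> \<longrightarrow> \<eta> \<le> \<eta>\<^sub>0 \<longrightarrow> alg_stops f \<eta> x q m \<longrightarrow>
        alg_output f \<eta> x q m = {x_star} \<and>
        hausdorff_distance (polygonal_line q m) (\<gamma> ` {0..}) < ennreal \<epsilon>"
      using converges[OF \<open>\<epsilon> > 0\<close>] by (elim exE conjE)
    have "\<forall>\<^sub>F \<eta> in at_right 0. \<eta> \<in> {0<..<\<eta>\<^sub>0}"
      using \<eta>\<^sub>0(1) by (rule eventually_at_right_real)
    then show "\<forall>\<^sub>F \<eta> in at_right 0. \<forall>q m. alg_stops f \<eta> x q m \<longrightarrow>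
        hausdorff_distance (polygonal_line q m) (\<gamma> ` {0..}) < ennreal \<epsilon>"
      by eventually_elim (use \<eta>\<^sub>0(2) in auto)
  qed
qed

end
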